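(* Let $(x_0,v_0),(x_1,v_1)\in\mathcal H=\{(x,v)\in\mathbb R^2: v\ge 0\}$ with $x_0\neq x_1$, and put $m=\min(v_0,v_1)$, $M=\max(v_0,v_1)$. (i) Suppose $$|x_1-x_0|\le F\Bigl(m,M,\tfrac{1}{\sqrt{M}}\Bigr).$$ Then the equation $$x_1-x_0=\frac{\sqrt{v_0}\sqrt{1-C^2v_0}}{C}-\frac{\arcsin(C\sqrt{v_0})}{C^2}-\left[\frac{\sqrt{v_1}\sqrt{1-C^2v_1}}{C}-\frac{\arcsin(C\sqrt{v_1})}{C^2}\right]$$ (that is, $F(v_0,v_1,C)=x_1-x_0$) has a unique solution $C=C^*$ in the interval $I=\bigl[-\min(v_0^{-1/2},v_1^{-1/2}),\ \min(v_0^{-1/2},v_1^{-1/2})\bigr]$, and $$d_H((x_0,v_0),(x_1,v_1))=2\,\frac{\arcsin(C^*\sqrt{M})-\arcsin(C^*\sqrt{m})}{C^*}.$$ (ii) Suppose $$|x_1-x_0|\ge F\Bigl(m,M,\tfrac{1}{\sqrt{M}}\Bigr).$$ Then the equation $$|x_1-x_0|=\frac{\sqrt{v_0}\sqrt{1-C^2v_0}}{C}+\frac{\arccos(C\sqrt{v_0})}{C^2}+\frac{\sqrt{v_1}\sqrt{1-C^2v_1}}{C}+\frac{\arccos(C\sqrt{v_1})}{C^2}$$ has a unique solution $C=C^*$ in the interval $\bigl(0,\min(v_0^{-1/2},v_1^{-1/2})\bigr]$, and $$d_H((x_0,v_0),(x_1,v_1))=2\,\frac{\arccos(C^*\sqr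t{v_0})+\arccos(C^*\sqrt{v_1})}{C^*}.$$
   Context: The Heston distance $d_H$: on the open half-plane $\mathcal H^\circ=\{(x,v)\in\mathbb R^2:v>0\}$ consider the Riemannian metric $ds^2=v^{-1}(dx^2+dv^2)$; $d_H$ is the associated Riemannian distance (infimum of lengths of piecewise $C^1$ curves in $\mathcal H^\circ$), extended by continuity to the closed half-plane $\mathcal H$. For $C\ne 0$ and $v\in[0,C^{-2}]$ put $$\overline F(v,C)=\frac{\arcsin(C\sqrt v)}{C^2}-\frac{\sqrt v\sqrt{1-C^2v}}{C}.$$ For $v_0,v_1\ge 0$ and $0<|C|\le\min(v_0^{-1/2},v_1^{-1/2})$ put $F(v_0,v_1,C)=\overline F(v_1,C)-\overline F(v_0,C)$, and extend continuously by $F(v_0,v_1,0)=0$ (the right-hand side of the equation in (i) is understood as $0$ at $C=0$). Conventions: $0^{-1/2}=+\infty$. If $v_0=v_1=0$, the threshold $F(m,M,1/\sqrt M)$ is interpreted as $0$ and the interval in (ii) is $(0,\infty)$. *)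

theory Defs
  imports "HOL-Analysis.Analysis"
begin

definition open_half_plane :: "(real \<times> real) set" where
  "open_half_plane = {p. snd p > 0}"

(* Norm of the tangent vector w at p in the metric (dx^2 + dv^2) / v. *)
definition heston_norm :: "real \<times> real \<Rightarrow> real \<times> real \<Rightarrow> real" where
  "heston_norm p w = sqrt (((fst w)\<^sup>2 + (snd w)\<^sup>2) / snd p)"

(* The length takes values in [0, \<infinity>] because the derivative of a valid_path may be
   unbounded near the exceptional points.  Paths of infinite length then have no effect on the
   infimum below, whereas a real-valued integral would give the value 0 to those whose speed
   is not integrable. *)
definition heston_length :: "(real \<Rightarrow> real \<times> real) \<Rightarrow> ennreal" where
  "heston_length g =
     (\<integral>\<^sup>+ t \<in> {0..1}. ennreal (heston_norm (g t) (vector_derivative g (at t))) \<partial>lborel)"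

definition heston_dist_open :: "real \<times> real \<Rightarrow> real \<times> real \<Rightarrow> real" where
  "heston_dist_open p q =
     enn2real (INF g \<in> {g. valid_path g \<and> path_image g \<subseteq> open_half_plane \<and>
                           pathstart g = p \<and> pathfinish g = q}. heston_length g)"

(* Extension by continuity, jointly in both points, to the closed half-plane. *)
definition heston_dist :: "real \<times> real \<Rightarrow> real \<times> real \<Rightarrow> real" where
  "heston_dist p q =
     (if p \<in> open_half_plane \<and> q \<in> open_half_plane then heston_dist_open p q
      else Lim (at (p, q) within open_half_plane \<times> open_half_plane)
             (\<lambda>(p', q'). heston_dist_open p' q'))"

definition Fbar :: "real \<Rightarrow> real \<Rightarrow> real" where
  "Fbar v C = arcsin (C * sqrt v) / C\<^sup>2 - sqrt v * sqrt (1 - C\<^sup>2 * v) / C"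

definition heston_F :: "real \<Rightarrow> real \<Rightarrow> real \<Rightarrow> real" where
  "heston_F v0 v1 C = (if C = 0 then 0 else Fbar v1 C - Fbar v0 C)"

(* The threshold F(m, M, 1/sqrt M). *)
definition heston_threshold :: "real \<Rightarrow> real \<Rightarrow> real" where
  "heston_threshold m M = (if M = 0 then 0 else heston_F m M (1 / sqrt M))"

(* min (v0 powr (-1/2)) (v1 powr (-1/2)) with value \<infinity> at v = 0:
   inverse 0 = \<infinity> on ereal, while 0 powr (-1/2) = 0 on real. *)
definition C_max :: "real \<Rightarrow> real \<Rightarrow> ereal" where
  "C_max v0 v1 = min (inverse (ereal (sqrt v0))) (inverse (ereal (sqrt v1)))"

definition arcsin_rhs :: "real \<Rightarrow> real \<Rightarrow> real \<Rightarrow> real" where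
  "arcsin_rhs v0 v1 C =
     (if C = 0 then 0
      else sqrt v0 * sqrt (1 - C\<^sup>2 * v0) / C - arcsin (C * sqrt v0) / C\<^sup>2
           - (sqrt v1 * sqrt (1 - C\<^sup>2 * v1) / C - arcsin (C * sqrt v1) / C\<^sup>2))"

lemma arcsin_rhs_eq_heston_F: "arcsin_rhs v0 v1 C = heston_F v0 v1 C"
  by (simp add: arcsin_rhs_def heston_F_def Fbar_def)

definition arccos_rhs :: "real \<Rightarrow> real \<Rightarrow> real \<Rightarrow> real" where
  "arccos_rhs v0 v1 C =
     sqrt v0 * sqrt (1 - C\<^sup>2 * v0) / C + arccos (C * sqrt v0) / C\<^sup>2
     + sqrt v1 * sqrt (1 - C\<^sup>2 * v1) / C + arccos (C * sqrt v1) / C\<^sup>2"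

end

theory Submission
  imports Defs "HOL-Real_Asymp.Real_Asymp"
begin

text \<open>Geodesics of the Heston metric are the cycloids
  \<open>(a + r (\<phi> - sin \<phi> cos \<phi>), r sin\<^sup>2 \<phi>)\<close> with \<open>r = 1 / C\<^sup>2\<close>.  Those issuing from a boundary
  point \<open>(a, 0)\<close>, their mirror images and the line \<open>x = a\<close> foliate the open half-plane, and the
  Riemannian distance \<open>S\<close> to \<open>(a, 0)\<close>, whose value on such a cycloid is \<open>2 \<surd>r \<phi>\<close>, solves the
  eikonal equation \<open>v |\<nabla>S|\<^sup>2 = 1\<close> on the whole open
  half-plane.  Hence \<open>|S q - S p|\<close> bounds the length of every path from \<open>p\<close> to \<open>q\<close>, with
  equality along a cycloid: no arc has to be shown minimal by a second variation or
  completeness argument, although the metric is incomplete at the boundary.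

  For two points of distinct abscissae the distance is therefore the maximum of
  \<open>|S q - S p|\<close> over all \<open>a\<close>.  As all these \<open>S\<close> share one modulus of continuity up to the
  boundary, the distance formula extends to the closed half-plane by letting the end points move
  along a fixed arc.  Existence and uniqueness of \<open>C\<close> follow from monotonicity.\<close>

subsection \<open>The distance to a boundary point\<close>

text \<open>\<open>(x - a) / v\<close> on a cycloid from \<open>(a, 0)\<close>.  At \<open>\<phi> = 0\<close> the convention \<open>0 / 0 = 0\<close> gives the
  continuous extension.\<close>

definition cyc_ratio :: "real \<Rightarrow> real" where
  "cyc_ratio \<phi> = (\<phi> - sin \<phi> * cos \<phi>) / (sin \<phi>)\<^sup>2"

text \<open>The value 2/3 at 0 is the limit of the other branch, since
  \<open>sin \<phi> - \<phi> * cos \<phi>\<close> behaves like \<phi>^3 / 3.\<close>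

definition cyc_ratio_deriv :: "real \<Rightarrow> real" where
  "cyc_ratio_deriv \<phi> = (if \<phi> = 0 then 2/3 else 2 * (sin \<phi> - \<phi> * cos \<phi>) / sin \<phi> ^ 3)"

text \<open>The expression vanishes at 0 and has derivative x sin x. It is the numerator that makes
  \<open>cyc_ratio\<close> increasing.\<close>

lemma sin_minus_arg_cos_pos:
  fixes \<phi> :: real
  assumes "0 < \<phi>" "\<phi> < pi"
  shows "0 < sin \<phi> - \<phi> * cos \<phi>"
proof -
  have "\<exists>y. ((\<lambda>x. sin x - x * cos x) has_real_derivative y) (at x) \<and> y > 0"
    if "0 < x" "x < \<phi>" for x
    using that assms
    by (intro exI[of _ "x * sin x"] conjI)
       (auto intro!: derivative_eq_intros mult_pos_pos sin_gt_zero)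
  then have "sin 0 - 0 * cos 0 < sin \<phi> - \<phi> * cos \<phi>"
    by (intro DERIV_pos_imp_increasing_open[OF assms(1)]) (auto intro!: continuous_intros)
  then show ?thesis by simp
qed

lemma sin_neq_zero:
  fixes \<phi> :: real
  assumes "\<bar>\<phi>\<bar> < pi" "\<phi> \<noteq> 0"
  shows "sin \<phi> \<noteq> 0"
  using assms sin_gt_zero[of \<phi>] sin_gt_zero[of "-\<phi>"] by (cases "\<phi> > 0") auto

lemma cyc_ratio_minus: "cyc_ratio (- \<phi>) = - cyc_ratio \<phi>"
  by (simp add: cyc_ratio_def minus_divide_left)

lemma cyc_ratio_has_derivative:
  assumes "\<bar>\<phi>\<bar> < pi"
  shows "(cyc_ratio has_real_derivative cyc_ratio_deriv \<phi>) (at \<phi>)"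
proof (cases "\<phi> = 0")
  case True
  \<comment> \<open>As \<open>cyc_ratio 0 = 0\<close>, this is the limit of the difference quotient
    at 0.\<close>
  have "((\<lambda>h::real. (h - sin h * cos h) / (sin h)\<^sup>2 / h) \<longlongrightarrow> 2/3) (at 0)"
    by real_asymp
  then show ?thesis
    using True by (simp add: DERIV_def cyc_ratio_def cyc_ratio_deriv_def)
next
  case False
  have s: "sin \<phi> \<noteq> 0" using sin_neq_zero assms False .
  have c: "cos \<phi> ^ 2 = 1 - sin \<phi> ^ 2" by (simp add: cos_squared_eq)
  have "(cyc_ratio has_real_derivative
     ((1 - (cos \<phi> * cos \<phi> + sin \<phi> * (- sin \<phi>))) * (sin \<phi>)\<^sup>2 - (\<phi> - sin \<phi> * cos \<phi>) * (2 * sin \<phi> * cos \<phi>))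
      / ((sin \<phi>)\<^sup>2 * (sin \<phi>)\<^sup>2)) (at \<phi>)"
    unfolding cyc_ratio_def using s
    by (auto intro!: derivative_eq_intros simp: algebra_simps)
  moreover have "((1 - (cos \<phi> * cos \<phi> + sin \<phi> * (- sin \<phi>))) * (sin \<phi>)\<^sup>2 - (\<phi> - sin \<phi> * cos \<phi>) * (2 * sin \<phi> * cos \<phi>))
      / ((sin \<phi>)\<^sup>2 * (sin \<phi>)\<^sup>2) = cyc_ratio_deriv \<phi>"
    using s False c by (simp add: cyc_ratio_deriv_def divide_simps) algebra
  ultimately show ?thesis by simp
qed

text \<open>On (0, pi) this is \<open>sin_minus_arg_cos_pos\<close>; negative angles follow because
  the derivative is even.\<close>

lemma cyc_ratio_deriv_pos:
  assumes "\<bar>\<phi>\<bar> < pi"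
  shows "0 < cyc_ratio_deriv \<phi>"
proof -
  have pos: "0 < cyc_ratio_deriv \<phi>" if "0 < \<phi>" "\<phi> < pi" for \<phi>
    using that sin_minus_arg_cos_pos[of \<phi>] sin_gt_zero[of \<phi>] by (simp add: cyc_ratio_deriv_def)
  consider "\<phi> = 0" | "\<phi> > 0" | "- \<phi> > 0" by linarith
  then show ?thesis
  proof cases
    case 1
    then show ?thesis by (simp add: cyc_ratio_deriv_def)
  next
    case 2
    then show ?thesis using pos[of \<phi>] assms by linarith
  next
    case 3
    have "cyc_ratio_deriv (- \<phi>) = (- (2 * (sin \<phi> - \<phi> * cos \<phi>))) / (- (sin \<phi> ^ 3))"
      using 3 by (simp only: cyc_ratio_deriv_def sin_minus cos_minus power_minus_odd odd_numeral) simp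
    also have "\<dots> = cyc_ratio_deriv \<phi>"
      using 3 by (simp only: minus_divide_divide cyc_ratio_deriv_def) simp
    finally show ?thesis using pos[of "- \<phi>"] 3 assms by linarith
  qed
qed

lemma cyc_ratio_less:
  assumes "- pi < a" "a < b" "b < pi"
  shows "cyc_ratio a < cyc_ratio b"
proof (rule DERIV_pos_imp_increasing[OF assms(2)])
  fix x assume "a \<le> x" "x \<le> b"
  then have "\<bar>x\<bar> < pi" using assms by auto
  then show "\<exists>y. (cyc_ratio has_real_derivative y) (at x) \<and> 0 < y"
    using cyc_ratio_has_derivative cyc_ratio_deriv_pos by blast
qed

text \<open>As the angle rises to pi, the numerator tends to pi and the denominator to 0, so the
  ratio is unbounded and the intermediate value theorem applies.\<close>

lemma cyc_ratio_surj_nonneg: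
  assumes "0 \<le> z"
  shows "\<exists>\<phi>. 0 \<le> \<phi> \<and> \<phi> < pi \<and> cyc_ratio \<phi> = z"
proof -
  have "filterlim (\<lambda>x::real. (x - sin x * cos x) / (sin x)\<^sup>2) at_top (at_left pi)"
    by real_asymp
  then have "eventually (\<lambda>x. z \<le> cyc_ratio x) (at_left pi)"
    unfolding cyc_ratio_def[abs_def] filterlim_at_top by blast
  moreover have "eventually (\<lambda>x. x \<in> {0<..<pi}) (at_left pi)"
    by (rule eventually_at_left_real) simp
  ultimately have "eventually (\<lambda>x. z \<le> cyc_ratio x \<and> x \<in> {0<..<pi}) (at_left pi)"
    by eventually_elim auto
  then obtain b where b: "z \<le> cyc_ratio b" "0 < b" "b < pi"
    using eventually_happens'[OF trivial_limit_at_left_real] by auto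
  have "\<exists>x\<ge>0. x \<le> b \<and> cyc_ratio x = z"
  proof (rule IVT')
    show "cyc_ratio 0 \<le> z" using assms by (simp add: cyc_ratio_def)
    show "continuous_on {0..b} cyc_ratio"
      using b by (auto intro!: continuous_at_imp_continuous_on DERIV_isCont[OF cyc_ratio_has_derivative])
  qed (use b in auto)
  with b show ?thesis by fastforce
qed

lemma cyc_ratio_surj: "\<exists>\<phi>. \<bar>\<phi>\<bar> < pi \<and> cyc_ratio \<phi> = z"
proof (cases "0 \<le> z")
  case True
  then show ?thesis using cyc_ratio_surj_nonneg[of z] by force
next
  case False
  then obtain \<phi> where "0 \<le> \<phi>" "\<phi> < pi" "cyc_ratio \<phi> = - z"
    using cyc_ratio_surj_nonneg[of "- z"] by auto
  then show ?thesis by (intro exI[of _ "- \<phi>"]) (auto simp: cyc_ratio_minus)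
qed

text \<open>The inverse of \<open>cyc_ratio\<close> on (-pi, pi), well determined because
  \<open>cyc_ratio\<close> is strictly increasing and onto. Negative angles belong to the mirrored
  cycloids and angle 0 to the vertical line.\<close>

definition cyc_angle :: "real \<Rightarrow> real" where
  "cyc_angle z = (SOME \<phi>. \<bar>\<phi>\<bar> < pi \<and> cyc_ratio \<phi> = z)"

lemma cyc_angle_bound: "\<bar>cyc_angle z\<bar> < pi"
  and cyc_ratio_cyc_angle: "cyc_ratio (cyc_angle z) = z"
  using someI_ex[OF cyc_ratio_surj[of z]] by (auto simp: cyc_angle_def)

lemma cyc_angle_cyc_ratio:
  assumes "\<bar>\<phi>\<bar> < pi"
  shows "cyc_angle (cyc_ratio \<phi>) = \<phi>"
  using cyc_angle_bound[of "cyc_ratio \<phi>"] cyc_ratio_cyc_angle[of "cyc_ratio \<phi>"] assms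
    cyc_ratio_less[of \<phi> "cyc_angle (cyc_ratio \<phi>)"] cyc_ratio_less[of "cyc_angle (cyc_ratio \<phi>)" \<phi>]
  by (cases "cyc_angle (cyc_ratio \<phi>)" \<phi> rule: linorder_cases) (auto simp: abs_less_iff)

lemma cyc_angle_has_derivative:
  "(cyc_angle has_real_derivative inverse (cyc_ratio_deriv (cyc_angle z))) (at z)"
proof (rule DERIV_inverse_function[where f = cyc_ratio and a = "z - 1" and b = "z + 1"])
  show "(cyc_ratio has_real_derivative cyc_ratio_deriv (cyc_angle z)) (at (cyc_angle z))"
    by (rule cyc_ratio_has_derivative[OF cyc_angle_bound])
  show "cyc_ratio_deriv (cyc_angle z) \<noteq> 0"
    using cyc_ratio_deriv_pos[OF cyc_angle_bound, of z] by simp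
  \<comment> \<open>Half the distance to the ends of (-pi, pi), so that the closed d-neighbourhood
    of the angle stays inside.\<close>
  define d where "d = (pi - \<bar>cyc_angle z\<bar>) / 2"
  have "isCont cyc_angle (cyc_ratio (cyc_angle z))"
  proof (rule isCont_inverse_function[where f = cyc_ratio and x = "cyc_angle z" and d = d])
    show "0 < d" using cyc_angle_bound[of z] by (simp add: d_def)
    fix w assume "\<bar>w - cyc_angle z\<bar> \<le> d"
    then have w: "\<bar>w\<bar> < pi"
      using cyc_angle_bound[of z] abs_triangle_ineq[of "w - cyc_angle z" "cyc_angle z"]
      unfolding d_def by argo
    show "cyc_angle (cyc_ratio w) = w" by (rule cyc_angle_cyc_ratio[OF w])
    show "isCont cyc_ratio w" by (rule DERIV_isCont[OF cyc_ratio_has_derivative[OF w]])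
  qed
  then show "isCont cyc_angle z" by (simp add: cyc_ratio_cyc_angle)
qed (auto simp: cyc_ratio_cyc_angle)

text \<open>On a cycloid sqrt v = sqrt r sin \<phi>, so the distance 2 sqrt r \<phi> equals sqrt v
  times 2 \<phi> / sin \<phi>. The form chosen here agrees with that quotient and is smooth across
  \<phi> = 0.\<close>

definition cyc_profile :: "real \<Rightarrow> real" where
  "cyc_profile z = 2 * (z * sin (cyc_angle z) + cos (cyc_angle z))"

lemma cyc_profile_cyc_ratio:
  assumes "\<bar>\<phi>\<bar> < pi" "\<phi> \<noteq> 0"
  shows "cyc_profile (cyc_ratio \<phi>) = 2 * \<phi> / sin \<phi>"
proof -
  have "cyc_ratio \<phi> * sin \<phi> + cos \<phi> = \<phi> / sin \<phi>"
    using sin_neq_zero[OF assms] by (simp add: cyc_ratio_def power2_eq_square field_simps)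
  then show ?thesis by (simp add: cyc_profile_def cyc_angle_cyc_ratio[OF assms(1)])
qed

text \<open>The product rule leaves 2 sin \<phi> - 2 (sin \<phi> - z cos \<phi>) \<phi>'(z).
  Inserting z = \<open>cyc_ratio \<phi>\<close> and the derivative of the inverse function turns the
  subtracted term into sin \<phi>.\<close>

lemma cyc_profile_has_derivative:
  "(cyc_profile has_real_derivative sin (cyc_angle z)) (at z)"
proof -
  let ?f = "cyc_angle z" and ?D = "inverse (cyc_ratio_deriv (cyc_angle z))"
  have D: "(cyc_profile has_real_derivative
      2 * (sin ?f + (z * cos ?f - sin ?f) * ?D)) (at z)"
    unfolding cyc_profile_def
    by (rule derivative_eq_intros cyc_angle_has_derivative refl)+ (simp add: algebra_simps)
  have "2 * (sin ?f + (z * cos ?f - sin ?f) * ?D) = sin ?f"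
  proof (cases "?f = 0")
    case True
    then have "z = 0" using cyc_ratio_cyc_angle[of z] by (simp add: cyc_ratio_def)
    then show ?thesis using True by simp
  next
    case False
    have s: "sin ?f \<noteq> 0" by (rule sin_neq_zero[OF cyc_angle_bound False])
    have z: "z = (?f - sin ?f * cos ?f) / (sin ?f)\<^sup>2"
      using cyc_ratio_cyc_angle[of z] by (simp add: cyc_ratio_def)
    have n: "sin ?f - ?f * cos ?f \<noteq> 0"
      using cyc_ratio_deriv_pos[OF cyc_angle_bound, of z] False by (auto simp: cyc_ratio_deriv_def)
    have "sin ?f - z * cos ?f = (sin ?f - ?f * cos ?f) / (sin ?f)\<^sup>2"
    proof -
      have "sin ?f - z * cos ?f = (sin ?f * (sin ?f)\<^sup>2 - (?f - sin ?f * cos ?f) * cos ?f) / (sin ?f)\<^sup>2"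
        using s by (subst z) (simp add: field_simps)
      also have "sin ?f * (sin ?f)\<^sup>2 - (?f - sin ?f * cos ?f) * cos ?f = sin ?f - ?f * cos ?f"
        using sin_cos_squared_add[of ?f] by algebra
      finally show ?thesis .
    qed
    moreover have "n / s\<^sup>2 * inverse (2 * n / s ^ 3) = s / 2" if "n \<noteq> 0" "s \<noteq> 0" for n s :: real
      using that by (simp add: power2_eq_square power3_eq_cube)
    from this[OF n s] have "(sin ?f - ?f * cos ?f) / (sin ?f)\<^sup>2 * ?D = sin ?f / 2"
      using False by (simp add: cyc_ratio_deriv_def)
    ultimately have "(sin ?f - z * cos ?f) * ?D = sin ?f / 2" by simp
    then show ?thesis by (simp add: algebra_simps)
  qed
  then show ?thesis using D by (simp only:)
qed

section \<open>The eikonal function and its gradient\<close>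

definition eikonal :: "real \<Rightarrow> real \<Rightarrow> real \<Rightarrow> real" where
  "eikonal a x v = sqrt v * cyc_profile ((x - a) / v)"

text \<open>The gradient is (sin \<phi>, cos \<phi>) / sqrt v: the terms z sin \<phi> v' from the
  two factors cancel. Stating it along a curve makes it directly applicable to paths.\<close>

lemma eikonal_has_derivative:
  fixes a :: real
  assumes "(x has_real_derivative x') (at t)" "(v has_real_derivative v') (at t)" "0 < v t"
  defines "\<phi> \<equiv> cyc_angle ((x t - a) / v t)"
  shows "((\<lambda>t. eikonal a (x t) (v t)) has_real_derivative
           (sin \<phi> * x' + cos \<phi> * v') / sqrt (v t)) (at t)"
proof -
  define r where "r = sqrt (v t)"
  have r: "r > 0" "v t = r * r" using assms(3) by (auto simp: r_def)
  define z where "z = (x t - a) / v t"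
  have xz: "x t - a = z * v t" using assms(3) by (simp add: z_def)
  have "((\<lambda>t. (x t - a) / v t) has_real_derivative (x' * v t - (x t - a) * v') / (v t * v t)) (at t)"
    using assms by (auto intro!: derivative_eq_intros)
  from DERIV_chain2[OF cyc_profile_has_derivative this]
  have p: "((\<lambda>t. cyc_profile ((x t - a) / v t)) has_real_derivative
      sin \<phi> * ((x' * v t - (x t - a) * v') / (v t * v t))) (at t)"
    by (simp add: \<phi>_def)
  have "((\<lambda>t. sqrt (v t)) has_real_derivative v' / (2 * r)) (at t)"
    unfolding r_def using assms by (auto intro!: derivative_eq_intros simp: field_simps)
  from DERIV_mult[OF this p]
  have "((\<lambda>t. eikonal a (x t) (v t)) has_real_derivative
     v' / (2 * r) * (2 * (z * sin \<phi> + cos \<phi>)) + sin \<phi> * ((x' * v t - (x t - a) * v') / (v t * v t)) * r) (at t)"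
    by (simp add: eikonal_def[abs_def] cyc_profile_def \<phi>_def z_def r_def)
  also have "v' / (2 * r) * (2 * (z * sin \<phi> + cos \<phi>)) + sin \<phi> * ((x' * v t - (x t - a) * v') / (v t * v t)) * r
     = (sin \<phi> * x' + cos \<phi> * v') / r"
    unfolding xz r(2) using r(1) by (simp add: field_simps)
  finally show ?thesis by (simp add: r_def)
qed

text \<open>Cauchy-Schwarz with the unit vector (sin \<phi>, cos \<phi>); the discarded square is
  the component of the velocity orthogonal to it.\<close>

lemma eikonal_deriv_bound:
  assumes "0 < v"
  shows "\<bar>(sin \<phi> * x' + cos \<phi> * v') / sqrt v\<bar> \<le> heston_norm (x, v) (x', v')"
proof -
  have "(sin \<phi> * x' + cos \<phi> * v')\<^sup>2 + (cos \<phi> * x' - sin \<phi> * v')\<^sup>2 = x'\<^sup>2 + v'\<^sup>2"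
    using sin_cos_squared_add[of \<phi>] by algebra
  then have "(sin \<phi> * x' + cos \<phi> * v')\<^sup>2 \<le> x'\<^sup>2 + v'\<^sup>2"
    by (smt (verit) zero_le_power2)
  then have "\<bar>sin \<phi> * x' + cos \<phi> * v'\<bar> \<le> sqrt (x'\<^sup>2 + v'\<^sup>2)"
    by (simp add: real_le_rsqrt)
  then show ?thesis
    using assms by (simp add: heston_norm_def real_sqrt_divide divide_right_mono)
qed

subsection \<open>Lengths of paths and cycloidal arcs\<close>

text \<open>Integrate the derivative bound along the path. The speed may be unbounded near
  exceptional points, so the fundamental theorem is used in its gauge-integral form and compared
  with the Lebesgue integral of the speed only when the length is finite.\<close>

lemma eikonal_le_length:
  assumes "valid_path g" "path_image g \<subseteq> open_half_plane"
  defines "p \<equiv> pathstart g" and "q \<equiv> pathfinish g"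
  shows "ennreal \<bar>eikonal a (fst q) (snd q) - eikonal a (fst p) (snd p)\<bar> \<le> heston_length g"
proof -
  obtain S where S: "finite S" "continuous_on {0..1} g" "g C1_differentiable_on ({0..1} - S)"
    using assms(1) unfolding valid_path_def piecewise_C1_differentiable_on_def by blast
  then obtain D where D: "\<And>t. t \<in> {0..1} - S \<Longrightarrow> (g has_vector_derivative D t) (at t)"
      "continuous_on ({0..1} - S) D"
    unfolding C1_differentiable_on_def by blast
  have pos: "snd (g t) > 0" if "t \<in> {0..1}" for t
    using assms(2) that by (auto simp: path_image_def open_half_plane_def image_subset_iff)
  \<comment> \<open>The speed, set to 0 at the exceptional points; this null set does not affect the
    length.\<close>
  define N where "N t = indicator ({0..1} - S) t *\<^sub>R heston_norm (g t) (D t)" for t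
  have N_nonneg: "0 \<le> N t" for t
    using pos[of t] by (auto simp: N_def indicator_def heston_norm_def)
  have "continuous_on ({0..1} - S) (\<lambda>t. heston_norm (g t) (D t))"
    unfolding heston_norm_def using pos
    by (intro continuous_intros D(2) continuous_on_subset[OF S(2)]) force+
  moreover have "{0..1} - S \<in> sets borel"
    by (intro sets.Diff borel_closed closed_atLeastAtMost finite_imp_closed S(1))
  ultimately have "N \<in> borel_measurable borel"
    unfolding N_def[abs_def] by (intro borel_measurable_continuous_on_indicator)
  then have N_meas: "N \<in> borel_measurable lborel" by simp
  have "AE t in lborel. t \<notin> S"
    by (rule AE_not_in[OF finite_imp_null_set_lborel[OF S(1)]])
  then have len: "heston_length g = (\<integral>\<^sup>+ t. ennreal (N t) \<partial>lborel)"
    unfolding heston_length_def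
    by (intro nn_integral_cong_AE, eventually_elim)
       (auto simp: N_def indicator_def vector_derivative_at[OF D(1)])
  define f where "f t = eikonal a (fst (g t)) (snd (g t))" for t
  define f' where "f' t = (let \<phi> = cyc_angle ((fst (g t) - a) / snd (g t)) in
      (sin \<phi> * fst (D t) + cos \<phi> * snd (D t)) / sqrt (snd (g t)))" for t
  have f_deriv: "(f has_vector_derivative f' t) (at t)" if t: "t \<in> {0..1} - S" for t
  proof -
    note D_fst = bounded_linear.has_vector_derivative[OF bounded_linear_fst D(1)[OF t]]
    note D_snd = bounded_linear.has_vector_derivative[OF bounded_linear_snd D(1)[OF t]]
    show ?thesis
      unfolding f_def[abs_def] f'_def Let_def has_real_derivative_iff_has_vector_derivative[symmetric]
      using D_fst D_snd pos[of t] t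
      by (intro eikonal_has_derivative) (simp_all add: has_real_derivative_iff_has_vector_derivative)
  qed
  have f_cont: "continuous_on {0..1} f"
  proof -
    have "continuous_on UNIV cyc_profile"
      by (auto intro!: continuous_at_imp_continuous_on DERIV_isCont[OF cyc_profile_has_derivative])
    moreover have "continuous_on {0..1} (\<lambda>t. (fst (g t) - a) / snd (g t))"
      using pos by (intro continuous_intros S(2)) force
    ultimately have "continuous_on {0..1} (\<lambda>t. cyc_profile ((fst (g t) - a) / snd (g t)))"
      by (rule continuous_on_compose2) auto
    then show ?thesis
      unfolding f_def[abs_def] eikonal_def by (intro continuous_intros S(2))
  qed
  have "(f' has_integral (f 1 - f 0)) {0..1}"
    using S(1) f_cont by (intro fundamental_theorem_of_calculus_interior_strong) (auto intro: f_deriv)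
  \<comment> \<open>Resetting the integrand to 0 on S makes its bound by N hold at every t in the
    unit interval.\<close>
  then have f'_int: "((\<lambda>t. if t \<in> S then 0 else f' t) has_integral (f 1 - f 0)) {0..1}"
    by (rule has_integral_spike_finite[OF S(1), rotated]) auto
  show ?thesis
  proof (cases "heston_length g = \<infinity>")
    case False
    have int: "integrable lborel N"
      using N_meas N_nonneg False len by (intro integrableI_nonneg) (auto simp: top.not_eq_extremum)
    have N_supp: "(\<lambda>t. if t \<in> {0..1} then N t else 0) = N"
      by (auto simp: N_def indicator_def)
    have "(N has_integral integral\<^sup>L lborel N) UNIV" by (rule has_integral_integral_lborel[OF int])
    then have N_int: "(N has_integral integral\<^sup>L lborel N) {0..1}"
      using has_integral_restrict_UNIV[of "{0..1}" N] by (simp only: N_supp)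
    have bound: "norm (if t \<in> S then 0 else f' t) \<le> N t" if "t \<in> {0..1}" for t
      using that pos[OF that]
        eikonal_deriv_bound[of "snd (g t)" _ "fst (D t)" "snd (D t)" "fst (g t)"]
      by (auto simp: N_def f'_def Let_def)
    have "\<bar>f 1 - f 0\<bar> \<le> integral\<^sup>L lborel N"
      using integral_norm_bound_integral[OF has_integral_integrable[OF f'_int] has_integral_integrable[OF N_int] bound]
      by (simp add: integral_unique[OF f'_int] integral_unique[OF N_int])
    then have "ennreal \<bar>f 1 - f 0\<bar> \<le> heston_length g"
      unfolding len nn_integral_eq_integral[OF int AE_I2[OF N_nonneg]] by (rule ennreal_leI)
    then show ?thesis by (simp add: p_def q_def f_def pathstart_def pathfinish_def)
  qed simp
qed

text \<open>The parameter is half the rolling angle of a circle of radius r / 2, so one arch is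
  \<phi> in [0, pi] with its top at pi / 2.\<close>

definition cyc_point :: "real \<Rightarrow> real \<Rightarrow> real \<Rightarrow> real \<times> real" where
  "cyc_point a r \<phi> = (a + r * (\<phi> - sin \<phi> * cos \<phi>), r * (sin \<phi>)\<^sup>2)"

lemma eikonal_cyc_point:
  assumes "0 < r" "0 < \<phi>" "\<phi> < pi"
  shows "eikonal a (fst (cyc_point a r \<phi>)) (snd (cyc_point a r \<phi>)) = 2 * sqrt r * \<phi>"
proof -
  have s: "0 < sin \<phi>" using assms sin_gt_zero by auto
  have "(fst (cyc_point a r \<phi>) - a) / snd (cyc_point a r \<phi>) = cyc_ratio \<phi>"
    using assms s by (simp add: cyc_point_def cyc_ratio_def)
  then show ?thesis
    using assms s
    by (simp add: eikonal_def cyc_profile_cyc_ratio) (simp add: cyc_point_def real_sqrt_mult)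
qed

context
  fixes a r \<phi> \<psi> :: real
  assumes r: "0 < r" and \<phi>: "0 < \<phi>" "\<phi> < pi" and \<psi>: "0 < \<psi>" "\<psi> < pi"
begin

definition cyc_path :: "real \<Rightarrow> real \<times> real" where
  "cyc_path t = cyc_point a r (\<phi> + t * (\<psi> - \<phi>))"

lemma cyc_path_derivative:
  "(cyc_path has_vector_derivative
     (let \<theta> = \<phi> + t * (\<psi> - \<phi>) in
       (2 * r * (sin \<theta>)\<^sup>2 * (\<psi> - \<phi>), 2 * r * sin \<theta> * cos \<theta> * (\<psi> - \<phi>)))) (at t)"
proof -
  define \<theta> where "\<theta> = \<phi> + t * (\<psi> - \<phi>)"
  have c: "1 - cos \<theta> * cos \<theta> + sin \<theta> * sin \<theta> = 2 * (sin \<theta>)\<^sup>2"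
    using sin_cos_squared_add[of \<theta>] by algebra
  have "((\<lambda>t. a + r * ((\<phi> + t * (\<psi> - \<phi>)) - sin (\<phi> + t * (\<psi> - \<phi>)) * cos (\<phi> + t * (\<psi> - \<phi>))))
     has_real_derivative r * ((1 - cos \<theta> * cos \<theta> + sin \<theta> * sin \<theta>) * (\<psi> - \<phi>))) (at t)"
    unfolding \<theta>_def by (auto intro!: derivative_eq_intros simp: algebra_simps)
  moreover have "((\<lambda>t. r * (sin (\<phi> + t * (\<psi> - \<phi>)))\<^sup>2)
     has_real_derivative 2 * r * sin \<theta> * cos \<theta> * (\<psi> - \<phi>)) (at t)"
    unfolding \<theta>_def by (auto intro!: derivative_eq_intros simp: algebra_simps)
  ultimately show ?thesis
    unfolding c \<theta>_def[symmetric] Let_def cyc_path_def[abs_def] cyc_point_def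
      has_real_derivative_iff_has_vector_derivative
    by (intro has_vector_derivative_Pair) (simp_all add: mult.assoc mult.left_commute)
qed

lemma cyc_angle_between:
  assumes "t \<in> {0..1}"
  shows "0 < \<phi> + t * (\<psi> - \<phi>)" "\<phi> + t * (\<psi> - \<phi>) < pi"
proof -
  have eq: "\<phi> + t * (\<psi> - \<phi>) = (1 - t) *\<^sub>R \<phi> + t *\<^sub>R \<psi>" by (simp add: algebra_simps)
  have "(1 - t) *\<^sub>R \<phi> + t *\<^sub>R \<psi> \<in> {0<..<pi}"
    by (rule convexD) (use \<phi> \<psi> assms in auto)
  then show "0 < \<phi> + t * (\<psi> - \<phi>)" "\<phi> + t * (\<psi> - \<phi>) < pi" by (simp_all add: eq)
qed

lemma valid_cyc_path: "valid_path cyc_path"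
  unfolding valid_path_def
proof (rule C1_differentiable_imp_piecewise)
  show "cyc_path C1_differentiable_on {0..1}"
    unfolding C1_differentiable_on_def Let_def
    by (rule exI, rule conjI, rule ballI, rule cyc_path_derivative)
       (auto simp: Let_def intro!: continuous_intros)
qed

lemma cyc_path_image: "path_image cyc_path \<subseteq> open_half_plane"
  using cyc_angle_between r
  by (auto simp: path_image_def open_half_plane_def cyc_path_def cyc_point_def
      intro!: mult_pos_pos zero_less_power sin_gt_zero)

text \<open>The squared Euclidean speed is 4 r^2 sin^2 \<theta> (\<psi> - \<phi>)^2 and the height
  is r sin^2 \<theta>, so the Heston speed is constant.\<close>

lemma cyc_path_length: "heston_length cyc_path = ennreal (2 * sqrt r * \<bar>\<psi> - \<phi>\<bar>)"
proof -
  have speed: "heston_norm (cyc_path t) (vector_derivative cyc_path (at t)) = 2 * sqrt r * \<bar>\<psi> - \<phi>\<bar>"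
    if t: "t \<in> {0..1}" for t
  proof -
    define \<theta> where "\<theta> = \<phi> + t * (\<psi> - \<phi>)"
    have s: "0 < sin \<theta>" using cyc_angle_between[OF t] sin_gt_zero by (simp add: \<theta>_def)
    have "((2 * r * (sin \<theta>)\<^sup>2 * (\<psi> - \<phi>))\<^sup>2 + (2 * r * sin \<theta> * cos \<theta> * (\<psi> - \<phi>))\<^sup>2)
        = (2 * \<bar>\<psi> - \<phi>\<bar>)\<^sup>2 * r * (r * (sin \<theta>)\<^sup>2)"
      using sin_cos_squared_add[of \<theta>] unfolding power_mult_distrib power2_abs by algebra
    then have "heston_norm (cyc_path t) (vector_derivative cyc_path (at t))
        = sqrt ((2 * \<bar>\<psi> - \<phi>\<bar>)\<^sup>2 * r)"
      using r s vector_derivative_at[OF cyc_path_derivative, of t]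
      by (simp add: heston_norm_def Let_def \<theta>_def[symmetric] cyc_path_def cyc_point_def)
    then show ?thesis by (simp add: real_sqrt_mult)
  qed
  have "heston_length cyc_path = (\<integral>\<^sup>+ t. ennreal (2 * sqrt r * \<bar>\<psi> - \<phi>\<bar>) * indicator {0..1} (t :: real) \<partial>lborel)"
    unfolding heston_length_def
    by (intro nn_integral_cong) (auto simp: indicator_def speed)
  then show ?thesis by (simp add: nn_integral_cmult_indicator)
qed

text \<open>The arc bounds the infimum from above, and every eikonal function bounds it from below.
  For the base point a of the arc itself the two bounds coincide.\<close>

lemma heston_dist_open_cyc_point_eikonal:
  defines "p \<equiv> cyc_point a r \<phi>" and "q \<equiv> cyc_point a r \<psi>"
  shows "heston_dist_open p q = 2 * sqrt r * \<bar>\<psi> - \<phi>\<bar>"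
    and "\<bar>eikonal b (fst q) (snd q) - eikonal b (fst p) (snd p)\<bar> \<le> heston_dist_open p q"
    and "\<bar>eikonal a (fst q) (snd q) - eikonal a (fst p) (snd p)\<bar> = heston_dist_open p q"
proof -
  define I where "I = (INF g \<in> {g. valid_path g \<and> path_image g \<subseteq> open_half_plane \<and>
                           pathstart g = p \<and> pathfinish g = q}. heston_length g)"
  have lower: "ennreal \<bar>eikonal b (fst q) (snd q) - eikonal b (fst p) (snd p)\<bar> \<le> I" for b
    unfolding I_def by (rule INF_greatest) (use eikonal_le_length in auto)
  have "I \<le> heston_length cyc_path"
    unfolding I_def
    by (rule INF_lower)
       (auto simp: valid_cyc_path subsetD[OF cyc_path_image] pathstart_def pathfinish_def cyc_path_def p_def q_def)
  then have upper: "I \<le> ennreal (2 * sqrt r * \<bar>\<psi> - \<phi>\<bar>)" by (simp add: cyc_path_length)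
  have ends: "\<bar>eikonal a (fst q) (snd q) - eikonal a (fst p) (snd p)\<bar> = 2 * sqrt r * \<bar>\<psi> - \<phi>\<bar>"
    using eikonal_cyc_point[OF r \<phi>] eikonal_cyc_point[OF r \<psi>] r
    by (simp add: p_def q_def abs_mult flip: right_diff_distrib)
  have I: "I = ennreal (2 * sqrt r * \<bar>\<psi> - \<phi>\<bar>)"
    using lower[of a] upper unfolding ends by (rule antisym[rotated])
  have d: "heston_dist_open p q = enn2real I" by (simp add: heston_dist_open_def I_def)
  show D: "heston_dist_open p q = 2 * sqrt r * \<bar>\<psi> - \<phi>\<bar>" using r by (simp add: d I)
  show "\<bar>eikonal b (fst q) (snd q) - eikonal b (fst p) (snd p)\<bar> \<le> heston_dist_open p q"
    using lower[of b] r unfolding I D by (subst (asm) ennreal_le_iff) auto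
  show "\<bar>eikonal a (fst q) (snd q) - eikonal a (fst p) (snd p)\<bar> = heston_dist_open p q"
    by (simp only: ends D)
qed

end

text \<open>The length of the route from \<open>p\<close> vertically up to height \<open>u\<close>, horizontally, and down to
  \<open>q\<close> is at most \<open>route_bound p q\<close>, where \<open>u\<close> is the larger height plus the horizontal distance.\<close>

definition route_bound :: "real \<times> real \<Rightarrow> real \<times> real \<Rightarrow> real" where
  "route_bound p q = 4 * sqrt (max (snd p) (snd q) + \<bar>fst p - fst q\<bar>)
     - 2 * sqrt (snd p) - 2 * sqrt (snd q) + sqrt \<bar>fst p - fst q\<bar>"

text \<open>The v-derivative is at most 1 / sqrt v in absolute value, which is the derivative of 2
  sqrt v. The factor c = 1 or -1 treats both signs at once.\<close>

lemma eikonal_vertical_bound: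
  assumes "0 < v" "v \<le> u"
  shows "\<bar>eikonal b x u - eikonal b x v\<bar> \<le> 2 * sqrt u - 2 * sqrt v"
proof -
  have "2 * sqrt v + c * eikonal b x v \<le> 2 * sqrt u + c * eikonal b x u" if c: "\<bar>c\<bar> = 1" for c
  proof (rule DERIV_nonneg_imp_nondecreasing[OF assms(2)])
    fix t assume "v \<le> t" "t \<le> u"
    then have t: "0 < t" using assms by simp
    define \<phi> where "\<phi> = cyc_angle ((x - b) / t)"
    have "((\<lambda>t. eikonal b x t) has_real_derivative (sin \<phi> * 0 + cos \<phi> * 1) / sqrt t) (at t)"
      unfolding \<phi>_def using t by (intro eikonal_has_derivative) auto
    then have "((\<lambda>t. 2 * sqrt t + c * eikonal b x t) has_real_derivative
        (1 + c * cos \<phi>) / sqrt t) (at t)"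
      using t by (auto intro!: derivative_eq_intros simp: field_simps)
    moreover have "\<bar>c * cos \<phi>\<bar> \<le> 1" using c by (simp add: abs_mult)
    ultimately show "\<exists>y. ((\<lambda>t. 2 * sqrt t + c * eikonal b x t) has_real_derivative y) (at t) \<and> 0 \<le> y"
      using t by (intro exI[of _ "(1 + c * cos \<phi>) / sqrt t"]) (auto simp: abs_le_iff)
  qed
  from this[of 1] this[of "-1"] show ?thesis by (simp add: abs_le_iff)
qed

lemma eikonal_horizontal_bound:
  assumes "0 < u"
  shows "\<bar>eikonal b y u - eikonal b x u\<bar> \<le> \<bar>y - x\<bar> / sqrt u"
proof -
  have D: "((\<lambda>t. eikonal b t u) has_real_derivative sin (cyc_angle ((t - b) / u)) / sqrt u) (at t)" for t
    using eikonal_has_derivative[of "\<lambda>t. t" 1 t "\<lambda>_. u" 0 b] assms by simp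
  have "norm (sin (cyc_angle ((t - b) / u)) / sqrt u) \<le> 1 / sqrt u" for t
    using assms by (simp add: divide_right_mono)
  then have "norm (eikonal b y u - eikonal b x u) \<le> 1 / sqrt u * norm (y - x)"
    using D by (intro field_differentiable_bound[of UNIV]) auto
  then show ?thesis by simp
qed

text \<open>Add the variation along the three legs of the route; the horizontal leg costs at most
  sqrt |x - y| because u is at least |x - y|. The bound does not depend on b and vanishes when the
  points merge, even on the boundary.\<close>

lemma eikonal_route_bound:
  assumes "p \<in> open_half_plane" "q \<in> open_half_plane"
  shows "\<bar>eikonal b (fst p) (snd p) - eikonal b (fst q) (snd q)\<bar> \<le> route_bound p q"
proof -
  obtain x v y w where pq: "p = (x, v)" "q = (y, w)" by (metis prod.collapse)
  have pos: "0 < v" "0 < w" using assms by (auto simp: pq open_half_plane_def)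
  define u where "u = max v w + \<bar>x - y\<bar>"
  have u: "v \<le> u" "w \<le> u" "\<bar>x - y\<bar> \<le> u" "0 < u" using pos by (auto simp: u_def)
  have "\<bar>x - y\<bar> = sqrt \<bar>x - y\<bar> * sqrt \<bar>x - y\<bar>" by simp
  also have "\<dots> \<le> sqrt \<bar>x - y\<bar> * sqrt u"
    using u by (intro mult_left_mono) auto
  finally have "\<bar>x - y\<bar> / sqrt u \<le> sqrt \<bar>x - y\<bar>"
    using u by (simp add: field_simps)
  then show ?thesis
    using eikonal_vertical_bound[OF pos(1) u(1), of b x] eikonal_vertical_bound[OF pos(2) u(2), of b y]
      eikonal_horizontal_bound[OF u(4), of b x y]
    unfolding route_bound_def pq fst_conv snd_conv u_def[symmetric] by linarith
qed

subsection \<open>The equations for the parameter of the cycloid\<close>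

text \<open>For y = sin \<phi> with \<phi> in [-pi/2, pi/2] this is \<phi> - sin \<phi> cos \<phi>,
  the abscissa of the cycloid for a = 0 and r = 1.\<close>

definition arcsin_area :: "real \<Rightarrow> real" where
  "arcsin_area y = arcsin y - y * sqrt (1 - y\<^sup>2)"

lemma Fbar_eq_arcsin_area:
  assumes "0 \<le> v"
  shows "Fbar v C = arcsin_area (C * sqrt v) / C\<^sup>2"
  using assms
  by (cases "C = 0") (simp_all add: Fbar_def arcsin_area_def power_mult_distrib field_simps power2_eq_square)

lemma arcsin_area_eq:
  assumes "\<bar>y\<bar> \<le> 1"
  shows "arcsin_area y = arcsin y - sin (arcsin y) * cos (arcsin y)"
  using assms by (simp add: arcsin_area_def cos_arcsin abs_le_iff)

lemma arcsin_area_minus: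
  assumes "\<bar>y\<bar> \<le> 1"
  shows "arcsin_area (- y) = - arcsin_area y"
  using assms by (simp add: arcsin_area_def arcsin_minus)

text \<open>From \<phi> \<le> tan \<phi> one gets \<phi> - sin \<phi> cos \<phi> \<le> sin^3 \<phi>
  / cos \<phi>. The cubic order survives the later division by C^2 as C tends to 0.\<close>

lemma arcsin_area_bounds:
  assumes "0 \<le> y" "y < 1"
  shows "0 \<le> arcsin_area y" "arcsin_area y \<le> y ^ 3 / sqrt (1 - y\<^sup>2)"
proof -
  define \<phi> where "\<phi> = arcsin y"
  have y: "y = sin \<phi>" and c: "sqrt (1 - y\<^sup>2) = cos \<phi>" using assms by (auto simp: \<phi>_def cos_arcsin)
  have \<phi>: "0 \<le> \<phi>" "\<phi> < pi/2"
    using assms arcsin_le_arcsin[of 0 y] arcsin_less_arcsin[of y 1] by (auto simp: \<phi>_def)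
  have cpos: "0 < cos \<phi>" using \<phi> by (intro cos_gt_zero_pi) auto
  have "sin \<phi> * cos \<phi> \<le> \<phi> * 1"
    using \<phi> cpos sin_x_le_x[of \<phi>] by (intro mult_mono) auto
  then show "0 \<le> arcsin_area y" 
    unfolding arcsin_area_def c \<phi>_def[symmetric] unfolding y by simp
  have "\<phi> * cos \<phi> \<le> sin \<phi>" using sin_minus_arg_cos_pos[of \<phi>] \<phi> by (cases "\<phi> = 0") auto
  then have "\<phi> \<le> sin \<phi> / cos \<phi>" using cpos by (simp add: field_simps)
  then have "\<phi> - sin \<phi> * cos \<phi> \<le> sin \<phi> / cos \<phi> - sin \<phi> * cos \<phi>" by simp
  also have "\<dots> = sin \<phi> ^ 3 / cos \<phi>"
  proof -
    have "sin \<phi> - sin \<phi> * cos \<phi> * cos \<phi> = sin \<phi> ^ 3"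
      using sin_cos_squared_add[of \<phi>] by algebra
    then show ?thesis using cpos by (simp add: field_simps)
  qed
  finally show "arcsin_area y \<le> y ^ 3 / sqrt (1 - y\<^sup>2)"
    unfolding c unfolding arcsin_area_def c \<phi>_def[symmetric] unfolding y .
qed

lemma arcsin_area_has_derivative:
  assumes "\<bar>y\<bar> < 1"
  shows "(arcsin_area has_real_derivative 2 * y\<^sup>2 / sqrt (1 - y\<^sup>2)) (at y)"
proof -
  have pos: "0 < 1 - y\<^sup>2" using assms by (simp add: abs_square_less_1)
  have "1 / sqrt (1 - y\<^sup>2) - (sqrt (1 - y\<^sup>2) - y\<^sup>2 / sqrt (1 - y\<^sup>2)) = 2 * y\<^sup>2 / sqrt (1 - y\<^sup>2)"
    using pos by (simp add: field_simps)
  moreover have "(arcsin_area has_real_derivative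
      1 / sqrt (1 - y\<^sup>2) - (sqrt (1 - y\<^sup>2) - y\<^sup>2 / sqrt (1 - y\<^sup>2))) (at y)"
    unfolding arcsin_area_def[abs_def] using assms pos
    by (auto intro!: derivative_eq_intros simp: field_simps power2_eq_square)
  ultimately show ?thesis by simp
qed

lemma continuous_on_arcsin_area: "continuous_on {-1..1} arcsin_area"
  unfolding arcsin_area_def[abs_def]
  by (intro continuous_intros continuous_on_arcsin') auto

section \<open>Strict monotonicity and range of F in the parameter C\<close>

context
  fixes m M :: real
  assumes m: "0 \<le> m" and mM: "m < M"
begin

lemma mul_sqrt_le_one:
  assumes "0 \<le> C" "C \<le> 1 / sqrt M" "0 \<le> v" "v \<le> M"
  shows "0 \<le> C * sqrt v" "C * sqrt v \<le> 1"
proof -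
  have "C * sqrt v \<le> 1 / sqrt M * sqrt M"
    using assms m mM by (intro mult_mono) auto
  then show "C * sqrt v \<le> 1" using m mM by simp
qed (use assms in simp)

text \<open>F(m, M, C) is the integral over [m, M] of the slope \<open>D C v\<close>, which
  increases strictly with C. The slope blows up at v = M when C' = 1 / sqrt M, so derivatives are
  compared on the open interval, with mere continuity at its ends.\<close>

lemma heston_F_less:
  assumes C: "0 \<le> C" "C < C'" "C' \<le> 1 / sqrt M"
  shows "heston_F m M C < heston_F m M C'"
proof -
  have C': "0 < C'" using C by simp
  \<comment> \<open>With C sqrt v = sin \<phi> this is tan \<phi> = dx/dv along the cycloid.\<close>
  define D where "D = (\<lambda>C v. C * sqrt v / sqrt (1 - (C * sqrt v)\<^sup>2))"
  have less1: "C' * sqrt v < 1" if "v < M" "0 \<le> v" for v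
  proof -
    have "C' * sqrt v < C' * sqrt M" using C' that by simp
    also have "\<dots> \<le> 1" using mul_sqrt_le_one[of C' M] C C' m mM by simp
    finally show ?thesis .
  qed
  have deriv: "((\<lambda>v. arcsin_area (c * sqrt v) / c\<^sup>2) has_real_derivative D c v) (at v)"
    if c: "0 < c" "c \<le> C'" and v: "0 < v" "v < M" for c v
  proof -
    have "c * sqrt v \<le> C' * sqrt v" using c v by (intro mult_right_mono) auto
    also have "\<dots> < 1" using less1[of v] v by simp
    finally have "c * sqrt v < 1" .
    then have y: "\<bar>c * sqrt v\<bar> < 1" using c v by simp
    have "((\<lambda>v. c * sqrt v) has_real_derivative c / (2 * sqrt v)) (at v)"
      using v by (auto intro!: derivative_eq_intros simp: field_simps)
    from DERIV_chain2[OF arcsin_area_has_derivative[OF y] this]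
    have "((\<lambda>v. arcsin_area (c * sqrt v) / c\<^sup>2) has_real_derivative
        (2 * (c * sqrt v)\<^sup>2 / sqrt (1 - (c * sqrt v)\<^sup>2) * (c / (2 * sqrt v))) / c\<^sup>2) (at v)"
      by (rule DERIV_cdivide)
    also have "(2 * (c * sqrt v)\<^sup>2 / sqrt (1 - (c * sqrt v)\<^sup>2) * (c / (2 * sqrt v))) / c\<^sup>2 = D c v"
      using c v by (simp add: D_def power2_eq_square)
    finally show ?thesis .
  qed
  have cont: "continuous_on {m..M} (\<lambda>v. arcsin_area (c * sqrt v) / c\<^sup>2)" if c: "0 < c" "c \<le> C'" for c
  proof -
    have "c * sqrt v \<in> {-1..1}" if "v \<in> {m..M}" for v
    proof -
      have "0 \<le> c * sqrt v" "c * sqrt v \<le> 1"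
        using mul_sqrt_le_one[of c v] c C m that by auto
      then show ?thesis by simp
    qed
    then show ?thesis using c
      by (intro continuous_intros continuous_on_compose2[OF continuous_on_arcsin_area]) auto
  qed
  have Dpos: "0 < D C' v" if "0 < v" "v < M" for v
    using that less1[of v] C' by (auto simp: D_def abs_square_less_1)
  have D_less: "D C v < D C' v" if v: "0 < v" "v < M" and "0 < C" for v
  proof -
    have y: "C * sqrt v < C' * sqrt v" "C' * sqrt v < 1" "0 < C * sqrt v"
      using C v less1[of v] \<open>0 < C\<close> by auto
    then have "(C * sqrt v)\<^sup>2 \<le> (C' * sqrt v)\<^sup>2" by (intro power_mono) auto
    moreover have "(C' * sqrt v)\<^sup>2 < 1" using y by (simp add: abs_square_less_1)
    ultimately show ?thesis
      unfolding D_def using y by (intro frac_less) auto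
  qed
  have Fbar: "Fbar v c = arcsin_area (c * sqrt v) / c\<^sup>2" if "v \<in> {m, M}" for v c
    using that m mM by (intro Fbar_eq_arcsin_area) auto
  show ?thesis
  proof (cases "C = 0")
    case True
    have "arcsin_area (C' * sqrt m) / C'\<^sup>2 < arcsin_area (C' * sqrt M) / C'\<^sup>2"
    proof (rule DERIV_pos_imp_increasing_open[OF mM])
      fix v assume "m < v" "v < M"
      then have v: "0 < v" "v < M" using m by auto
      show "\<exists>y. ((\<lambda>v. arcsin_area (C' * sqrt v) / C'\<^sup>2) has_real_derivative y) (at v) \<and> 0 < y"
        using deriv[OF C' order_refl v] Dpos[OF v] by blast
    qed (rule cont[OF C' order_refl])
    then show ?thesis using C' True by (simp add: heston_F_def Fbar)
  next
    case False
    with C have "0 < C" by simp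
    have "arcsin_area (C' * sqrt m) / C'\<^sup>2 - arcsin_area (C * sqrt m) / C\<^sup>2
        < arcsin_area (C' * sqrt M) / C'\<^sup>2 - arcsin_area (C * sqrt M) / C\<^sup>2"
    proof (rule DERIV_pos_imp_increasing_open[OF mM])
      fix v assume "m < v" "v < M"
      then have v: "0 < v" "v < M" using m by auto
      show "\<exists>y. ((\<lambda>v. arcsin_area (C' * sqrt v) / C'\<^sup>2 - arcsin_area (C * sqrt v) / C\<^sup>2)
          has_real_derivative y) (at v) \<and> 0 < y"
        using DERIV_diff[OF deriv[OF C' order_refl v] deriv[OF \<open>0 < C\<close> _ v]] D_less[OF v \<open>0 < C\<close>] C
        by (intro exI[of _ "D C' v - D C v"]) auto
    next
      show "continuous_on {m..M} (\<lambda>v. arcsin_area (C' * sqrt v) / C'\<^sup>2 - arcsin_area (C * sqrt v) / C\<^sup>2)"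
        using C C' \<open>0 < C\<close> by (intro continuous_on_diff cont) auto
    qed
    then show ?thesis using C' \<open>0 < C\<close> by (simp add: heston_F_def Fbar)
  qed
qed

text \<open>Dropping the nonnegative term at m and using the cubic bound at M leaves a majorant that
  tends to 0 with C. This supplies the left end for the intermediate value theorem without
  continuity at 0.\<close>

lemma heston_F_small:
  assumes "0 < \<epsilon>"
  shows "\<exists>C>0. C \<le> 1 / sqrt M \<and> heston_F m M C \<le> \<epsilon>"
proof -
  have M: "0 < M" using m mM by simp
  have "((\<lambda>C. M * (C * sqrt M) / sqrt (1 - (C * sqrt M)\<^sup>2)) \<longlongrightarrow> M * (0 * sqrt M) / sqrt (1 - (0 * sqrt M)\<^sup>2)) (at_right 0)"
    by (intro tendsto_intros) auto
  then have "eventually (\<lambda>C. M * (C * sqrt M) / sqrt (1 - (C * sqrt M)\<^sup>2) < \<epsilon>) (at_right 0)"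
    using assms by (auto dest: order_tendstoD(2))
  moreover have "eventually (\<lambda>C. C \<in> {0<..<1 / sqrt M}) (at_right 0)"
    using M by (intro eventually_at_right_real) auto
  ultimately have "eventually (\<lambda>C. M * (C * sqrt M) / sqrt (1 - (C * sqrt M)\<^sup>2) < \<epsilon> \<and> C \<in> {0<..<1 / sqrt M}) (at_right 0)"
    by eventually_elim auto
  then obtain C where C: "M * (C * sqrt M) / sqrt (1 - (C * sqrt M)\<^sup>2) < \<epsilon>" "0 < C" "C < 1 / sqrt M"
    using eventually_happens'[OF trivial_limit_at_right_real] by auto
  have y: "0 \<le> C * sqrt M" "C * sqrt M < 1" using C M by (auto simp: field_simps)
  have "C * sqrt m \<le> C * sqrt M" using C mM by simp
  then have "C * sqrt m < 1" using y(2) by (rule le_less_trans)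
  moreover have "0 \<le> C * sqrt m" using C m by simp
  ultimately have "0 \<le> Fbar m C"
    using arcsin_area_bounds(1)[of "C * sqrt m"] m by (simp add: Fbar_eq_arcsin_area)
  then have "heston_F m M C \<le> arcsin_area (C * sqrt M) / C\<^sup>2"
    using C M by (simp add: heston_F_def Fbar_eq_arcsin_area)
  also have "\<dots> \<le> ((C * sqrt M) ^ 3 / sqrt (1 - (C * sqrt M)\<^sup>2)) / C\<^sup>2"
    by (intro divide_right_mono arcsin_area_bounds y) auto
  also have "(C * sqrt M) ^ 3 = C\<^sup>2 * (M * (C * sqrt M))"
    using M by (simp add: power3_eq_cube power2_eq_square)
  finally have "heston_F m M C \<le> M * (C * sqrt M) / sqrt (1 - (C * sqrt M)\<^sup>2)"
    using C by simp
  then show ?thesis using C by (intro exI[of _ C]) auto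
qed

lemma heston_F_surj:
  assumes "0 < X" "X \<le> heston_F m M (1 / sqrt M)"
  shows "\<exists>C>0. C \<le> 1 / sqrt M \<and> heston_F m M C = X"
proof -
  obtain C0 where C0: "0 < C0" "C0 \<le> 1 / sqrt M" "heston_F m M C0 \<le> X"
    using heston_F_small[OF assms(1)] by blast
  have range: "C * sqrt v \<in> {-1..1}" if "C \<in> {C0..1 / sqrt M}" "v = m \<or> v = M" for C v
  proof -
    have "0 \<le> C * sqrt v" "C * sqrt v \<le> 1"
      using mul_sqrt_le_one[of C v] that C0 m mM by auto
    then show ?thesis by simp
  qed
  have "\<exists>C\<ge>C0. C \<le> 1 / sqrt M \<and> heston_F m M C = X"
  proof (rule IVT')
    have "continuous_on {C0..1 / sqrt M} (\<lambda>C. arcsin_area (C * sqrt M) / C\<^sup>2 - arcsin_area (C * sqrt m) / C\<^sup>2)"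
      using C0 range
      by (intro continuous_intros continuous_on_compose2[OF continuous_on_arcsin_area]) auto
    then show "continuous_on {C0..1 / sqrt M} (heston_F m M)"
      by (rule continuous_on_cong[THEN iffD1, rotated -1])
         (use C0 m mM in \<open>auto simp: heston_F_def Fbar_eq_arcsin_area\<close>)
  qed (use C0 assms in auto)
  then show ?thesis using C0(1) by (metis less_le_trans)
qed

lemma heston_F_minus:
  assumes "\<bar>C\<bar> \<le> 1 / sqrt M"
  shows "heston_F m M (- C) = - heston_F m M C"
proof -
  have "\<bar>C * sqrt v\<bar> \<le> 1" if "v = m \<or> v = M" for v
    using mul_sqrt_le_one[of "\<bar>C\<bar>" v] that assms m mM by (auto simp: abs_mult)
  then show ?thesis
    using m mM by (auto simp: heston_F_def Fbar_eq_arcsin_area arcsin_area_minus field_simps)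
qed

text \<open>Since F is odd in C, existence reduces to the positive value |X|, and strict
  monotonicity on nonnegative C extends to the whole symmetric interval.\<close>

lemma heston_F_unique:
  assumes "X \<noteq> 0" "\<bar>X\<bar> \<le> heston_F m M (1 / sqrt M)"
  shows "\<exists>!C. \<bar>C\<bar> \<le> 1 / sqrt M \<and> heston_F m M C = X"
proof (rule ex_ex1I)
  obtain C where C: "0 < C" "C \<le> 1 / sqrt M" "heston_F m M C = \<bar>X\<bar>"
    using heston_F_surj[of "\<bar>X\<bar>"] assms by auto
  show "\<exists>C. \<bar>C\<bar> \<le> 1 / sqrt M \<and> heston_F m M C = X"
  proof (cases "0 \<le> X")
    case True
    then show ?thesis using C by (intro exI[of _ C]) auto
  next
    case False
    then show ?thesis using C heston_F_minus[of C] by (intro exI[of _ "- C"]) auto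
  qed
next
  fix C C' assume C: "\<bar>C\<bar> \<le> 1 / sqrt M \<and> heston_F m M C = X" and C': "\<bar>C'\<bar> \<le> 1 / sqrt M \<and> heston_F m M C' = X"
  have F0: "heston_F m M 0 = 0" by (simp add: heston_F_def)
  have less: "heston_F m M C < heston_F m M C'" if "C < C'" "\<bar>C\<bar> \<le> 1 / sqrt M" "\<bar>C'\<bar> \<le> 1 / sqrt M" for C C'
  proof -
    consider "0 \<le> C" | "C' \<le> 0" | "C < 0" "0 < C'" by linarith
    then show ?thesis
    proof cases
      case 1
      then show ?thesis using that heston_F_less[of C C'] by auto
    next
      case 2
      then show ?thesis using that heston_F_less[of "- C'" "- C"] heston_F_minus by auto
    next
      case 3
      then show ?thesis
        using that heston_F_less[of 0 C'] heston_F_less[of 0 "- C"] heston_F_minus[of C] F0 by auto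
    qed
  qed
  show "C = C'" using less[of C C'] less[of C' C] C C' by (cases C C' rule: linorder_cases) auto
qed

end

section \<open>Strict monotonicity and range of the arccosine equation\<close>

lemma arccos_rhs_less:
  assumes "0 < C" "C < C'" "C' * sqrt v0 \<le> 1" "C' * sqrt v1 \<le> 1" "0 \<le> v0" "0 \<le> v1"
  shows "arccos_rhs v0 v1 C' < arccos_rhs v0 v1 C"
proof -
  have "sqrt v * sqrt (1 - C'\<^sup>2 * v) / C' + arccos (C' * sqrt v) / C'\<^sup>2
      < sqrt v * sqrt (1 - C\<^sup>2 * v) / C + arccos (C * sqrt v) / C\<^sup>2"
    if v: "0 \<le> v" "C' * sqrt v \<le> 1" for v
  proof (rule add_le_less_mono)
    have sq: "C\<^sup>2 \<le> C'\<^sup>2" "C\<^sup>2 < C'\<^sup>2" using assms by (auto intro: power_mono power_strict_mono)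
    have "(C' * sqrt v)\<^sup>2 \<le> 1" using v assms by (simp add: abs_square_le_1)
    then have "C'\<^sup>2 * v \<le> 1" using v by (simp add: power_mult_distrib)
    moreover have "C\<^sup>2 * v \<le> C'\<^sup>2 * v" using sq v by (simp add: mult_right_mono)
    ultimately show "sqrt v * sqrt (1 - C'\<^sup>2 * v) / C' \<le> sqrt v * sqrt (1 - C\<^sup>2 * v) / C"
      using assms v by (intro frac_le mult_left_mono mult_nonneg_nonneg) auto
    have y: "0 \<le> C * sqrt v" "C * sqrt v \<le> C' * sqrt v" using assms v by (auto simp: mult_right_mono)
    have lt1: "C * sqrt v < 1"
    proof (cases "v = 0")
      case False
      then have "C * sqrt v < C' * sqrt v" using assms v by simp
      then show ?thesis using v by simp
    qed simp
    \<comment> \<open>At v = 0 the arccosine does not change, so strictness is drawn from the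
      denominator C^2, using that the arccosine is positive.\<close>
    have "arccos (C' * sqrt v) \<le> arccos (C * sqrt v)"
      using y v by (intro arccos_le_arccos) auto
    moreover have "0 < arccos (C * sqrt v)"
      using y lt1 arccos_less_arccos[of "C * sqrt v" 1] by auto
    ultimately have "arccos (C' * sqrt v) / C'\<^sup>2 \<le> arccos (C * sqrt v) / C'\<^sup>2"
      and "arccos (C * sqrt v) / C'\<^sup>2 < arccos (C * sqrt v) / C\<^sup>2"
      using sq assms by (auto intro: divide_right_mono divide_strict_left_mono)
    then show "arccos (C' * sqrt v) / C'\<^sup>2 < arccos (C * sqrt v) / C\<^sup>2"
      by (rule le_less_trans)
  qed
  from this[of v0] this[of v1] show ?thesis using assms by (simp add: arccos_rhs_def)
qed

lemma arccos_rhs_surj: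
  assumes B: "0 < B" "B * sqrt v0 \<le> 1" "B * sqrt v1 \<le> 1"
    and v: "0 \<le> v0" "0 \<le> v1"
    and X: "arccos_rhs v0 v1 B \<le> X" "0 < X"
  shows "\<exists>C>0. C \<le> B \<and> arccos_rhs v0 v1 C = X"
proof -
  \<comment> \<open>The bound B / 2 keeps A sqrt w below 1/2, so the arccosine is at least pi / 3 >
    1/2; the bound 1 / sqrt X gives 1 / A^2 \<ge> X. Each of the two heights then contributes at
    least X / 2.\<close>
  define A where "A = min (B / 2) (1 / sqrt X)"
  have A: "0 < A" "A \<le> B" "A \<le> B / 2" "A \<le> 1 / sqrt X" using B X by (auto simp: A_def)
  have range: "0 \<le> C * sqrt w" "C * sqrt w \<le> 1"
    if "C \<in> {A..B}" "w = v0 \<or> w = v1" for C w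
  proof -
    show "0 \<le> C * sqrt w" using A that v by auto
    have "C * sqrt w \<le> B * sqrt w" using that v by (intro mult_right_mono) auto
    also have "\<dots> \<le> 1" using B that by auto
    finally show "C * sqrt w \<le> 1" .
  qed
  have "X / 2 \<le> sqrt w * sqrt (1 - A\<^sup>2 * w) / A + arccos (A * sqrt w) / A\<^sup>2" if w: "w = v0 \<or> w = v1" for w
  proof -
    have "A * sqrt w \<le> B / 2 * sqrt w" using A w v by (intro mult_right_mono) auto
    also have "\<dots> \<le> 1 / 2" using B w by auto
    finally have h: "A * sqrt w \<le> 1 / 2" .
    have "arccos (1 / 2) \<le> arccos (A * sqrt w)"
      using h range(1)[of A w] A w by (intro arccos_le_arccos) auto
    then have "1 / 2 \<le> arccos (A * sqrt w)" using pi_gt3 arccos_cos[of "pi / 3"] by (simp add: cos_60)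
    then have "(1 / 2) / A\<^sup>2 \<le> arccos (A * sqrt w) / A\<^sup>2" by (intro divide_right_mono) auto
    moreover have "X \<le> 1 / A\<^sup>2"
    proof -
      have "A\<^sup>2 \<le> (1 / sqrt X)\<^sup>2" using A by (intro power_mono) auto
      then have "A\<^sup>2 \<le> 1 / X" using X by (simp add: power_divide)
      then show ?thesis using A X by (simp add: field_simps)
    qed
    moreover have "(1 / 2) / A\<^sup>2 = (1 / A\<^sup>2) / 2" by simp
    ultimately have "X / 2 \<le> arccos (A * sqrt w) / A\<^sup>2" by linarith
    moreover have "0 \<le> sqrt w * sqrt (1 - A\<^sup>2 * w) / A"
    proof -
      have "(A * sqrt w)\<^sup>2 \<le> 1" using range[of A w] A w by (simp add: abs_square_le_1)
      then show ?thesis using w v A by (auto simp: power_mult_distrib)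
    qed
    ultimately show ?thesis by linarith
  qed
  from this[of v0] this[of v1] have ge: "X \<le> arccos_rhs v0 v1 A"
    unfolding arccos_rhs_def by linarith
  have "\<exists>C\<ge>A. C \<le> B \<and> arccos_rhs v0 v1 C = X"
  proof (rule IVT2')
    have arccos: "continuous_on {A..B} (\<lambda>C. arccos (C * sqrt w))" if "w = v0 \<or> w = v1" for w
      by (intro continuous_on_arccos continuous_intros) (use range[OF _ that] in force)
    have nz: "\<forall>C\<in>{A..B}. C \<noteq> 0" "\<forall>C\<in>{A..B}. C\<^sup>2 \<noteq> 0" using A by auto
    show "continuous_on {A..B} (arccos_rhs v0 v1)"
      unfolding arccos_rhs_def[abs_def]
      by (intro continuous_on_add continuous_on_divide continuous_on_mult continuous_on_const
          continuous_on_real_sqrt continuous_on_diff continuous_on_power continuous_on_id arccos nz) simp_all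
  qed (use A ge X in auto)
  then show ?thesis using A(1) by (metis less_le_trans)
qed

text \<open>For \<open>C < 0\<close> the arc lies on the descending half of the cycloid.\<close>

lemma arcsin_rhs_arc:
  assumes "C \<noteq> 0" "0 \<le> v0" "0 \<le> v1" "\<bar>C * sqrt v0\<bar> \<le> 1" "\<bar>C * sqrt v1\<bar> \<le> 1"
    and "x1 - x0 = arcsin_rhs v0 v1 C"
  defines "\<alpha> \<equiv> \<lambda>v. if 0 < C then arcsin (C * sqrt v) else pi + arcsin (C * sqrt v)"
  shows "\<exists>a. (x0, v0) = cyc_point a (1 / C\<^sup>2) (\<alpha> v0) \<and> (x1, v1) = cyc_point a (1 / C\<^sup>2) (\<alpha> v1)"
    and "\<alpha> v0 \<in> {0..pi}" "\<alpha> v1 \<in> {0..pi}"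
proof -
  define A where "A \<phi> = \<phi> - sin \<phi> * cos \<phi>" for \<phi> :: real
  have height: "v = 1 / C\<^sup>2 * (sin (\<alpha> v))\<^sup>2" if "\<bar>C * sqrt v\<bar> \<le> 1" "0 \<le> v" for v
    using that assms(1) by (auto simp: \<alpha>_def abs_le_iff power_mult_distrib)
  \<comment> \<open>Shifting the angle by pi leaves sin times cos unchanged, so the shift only adds
    pi, which cancels in the difference of abscissae.\<close>
  have A: "A (\<alpha> v) = (if 0 < C then 0 else pi) + arcsin_area (C * sqrt v)" if "\<bar>C * sqrt v\<bar> \<le> 1" for v
    using arcsin_area_eq[OF that] by (simp add: A_def \<alpha>_def)
  have "x1 - x0 = (A (\<alpha> v1) - A (\<alpha> v0)) / C\<^sup>2"
    using assms(1-6) by (simp add: arcsin_rhs_eq_heston_F heston_F_def Fbar_eq_arcsin_area A diff_divide_distrib)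
  then have "x1 = x0 - 1 / C\<^sup>2 * A (\<alpha> v0) + 1 / C\<^sup>2 * A (\<alpha> v1)" by (simp add: diff_divide_distrib)
  then show "\<exists>a. (x0, v0) = cyc_point a (1 / C\<^sup>2) (\<alpha> v0) \<and> (x1, v1) = cyc_point a (1 / C\<^sup>2) (\<alpha> v1)"
    using height[OF assms(4,2)] height[OF assms(5,3)]
    by (intro exI[of _ "x0 - 1 / C\<^sup>2 * A (\<alpha> v0)"]) (simp add: cyc_point_def A_def)
  have "\<alpha> v \<in> {0..pi}" if v: "0 \<le> v" "\<bar>C * sqrt v\<bar> \<le> 1" for v
  proof (cases "0 < C")
    case True
    then have "0 \<le> C * sqrt v" using v by simp
    then have "0 \<le> arcsin (C * sqrt v)" "arcsin (C * sqrt v) \<le> pi / 2"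
      using v arcsin_le_arcsin[of 0 "C * sqrt v"] arcsin_bounded[of "C * sqrt v"] by (auto simp: abs_le_iff)
    then show ?thesis using True pi_gt_zero by (auto simp: \<alpha>_def)
  next
    case False
    then have "C * sqrt v \<le> 0" using v by (simp add: mult_nonpos_nonneg)
    then have "arcsin (C * sqrt v) \<le> 0" "- (pi / 2) \<le> arcsin (C * sqrt v)"
      using v arcsin_le_arcsin[of "C * sqrt v" 0] arcsin_bounded[of "C * sqrt v"] by (auto simp: abs_le_iff)
    then show ?thesis using False pi_gt_zero by (auto simp: \<alpha>_def)
  qed
  then show "\<alpha> v0 \<in> {0..pi}" "\<alpha> v1 \<in> {0..pi}" using assms by auto
qed

text \<open>This arc passes over the top of the arch, with one end on each half;
  \<open>arccos (C * sqrt v)\<close> is the angle between an end and the top. The order of x0 and x1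
  decides which end lies on the ascending half.\<close>

lemma arccos_rhs_arc:
  assumes "0 < C" "0 \<le> v0" "0 \<le> v1" "C * sqrt v0 \<le> 1" "C * sqrt v1 \<le> 1"
    and "\<bar>x1 - x0\<bar> = arccos_rhs v0 v1 C"
  defines "\<alpha> \<equiv> \<lambda>v. arcsin (C * sqrt v)"
  defines "\<phi> \<equiv> if x0 \<le> x1 then \<alpha> v0 else pi - \<alpha> v0"
    and "\<psi> \<equiv> if x0 \<le> x1 then pi - \<alpha> v1 else \<alpha> v1"
  shows "\<exists>a. (x0, v0) = cyc_point a (1 / C\<^sup>2) \<phi> \<and> (x1, v1) = cyc_point a (1 / C\<^sup>2) \<psi>"
    and "\<phi> \<in> {0..pi}" "\<psi> \<in> {0..pi}"
    and "\<bar>\<psi> - \<phi>\<bar> = arccos (C * sqrt v0) + arccos (C * sqrt v1)"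
proof -
  have y: "- 1 \<le> C * sqrt v" if "0 \<le> v" for v
  proof -
    have "0 \<le> C * sqrt v" using assms(1) that by simp
    then show ?thesis by simp
  qed
  define A where "A \<phi> = \<phi> - sin \<phi> * cos \<phi>" for \<phi> :: real
  have s: "sin (\<alpha> v) = C * sqrt v" and c: "cos (\<alpha> v) = sqrt (1 - C\<^sup>2 * v)"
    if "C * sqrt v \<le> 1" "0 \<le> v" for v
    using that y[of v] by (auto simp: \<alpha>_def cos_arcsin power_mult_distrib)
  have arccos: "arccos (C * sqrt v) = pi / 2 - \<alpha> v" if "C * sqrt v \<le> 1" "0 \<le> v" for v
    using that y[of v] arccos_arcsin_eq[of "C * sqrt v"] by (simp add: \<alpha>_def)
  have \<alpha>: "0 \<le> \<alpha> v" "\<alpha> v \<le> pi / 2" if "C * sqrt v \<le> 1" "0 \<le> v" for v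
    using that assms(1) arcsin_le_arcsin[of 0 "C * sqrt v"] arcsin_bounded[of "C * sqrt v"] y[of v]
    by (auto simp: \<alpha>_def)
  show "\<phi> \<in> {0..pi}" "\<psi> \<in> {0..pi}"
    using \<alpha>[OF assms(4,2)] \<alpha>[OF assms(5,3)] pi_gt_zero by (auto simp: \<phi>_def \<psi>_def)
  show "\<bar>\<psi> - \<phi>\<bar> = arccos (C * sqrt v0) + arccos (C * sqrt v1)"
    using \<alpha>[OF assms(4,2)] \<alpha>[OF assms(5,3)] arccos[OF assms(4,2)] arccos[OF assms(5,3)]
    by (auto simp: \<phi>_def \<psi>_def)
  have "arccos_rhs v0 v1 C = (pi - A (\<alpha> v0) - A (\<alpha> v1)) / C\<^sup>2"
    using assms(1)
    by (simp add: arccos_rhs_def A_def s c arccos assms(2-5) field_simps power2_eq_square)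
  \<comment> \<open>Uses the reflection A(pi - t) = pi - A(t).\<close>
  then have "x1 - x0 = (A \<psi> - A \<phi>) / C\<^sup>2"
    using assms(6) by (auto simp: \<phi>_def \<psi>_def A_def diff_divide_distrib add_divide_distrib)
  then have "x1 = x0 - 1 / C\<^sup>2 * A \<phi> + 1 / C\<^sup>2 * A \<psi>" by (simp add: diff_divide_distrib)
  moreover have "v0 = 1 / C\<^sup>2 * (sin \<phi>)\<^sup>2" "v1 = 1 / C\<^sup>2 * (sin \<psi>)\<^sup>2"
    using assms(1) by (simp_all add: \<phi>_def \<psi>_def s assms(2-5) power_mult_distrib)
  ultimately show "\<exists>a. (x0, v0) = cyc_point a (1 / C\<^sup>2) \<phi> \<and> (x1, v1) = cyc_point a (1 / C\<^sup>2) \<psi>"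
    by (intro exI[of _ "x0 - 1 / C\<^sup>2 * A \<phi>"]) (simp add: cyc_point_def A_def)
qed

section \<open>Admissible parameters and unique solvability of the two equations\<close>

lemma le_C_max_iff:
  assumes "0 \<le> C" "0 \<le> v0" "0 \<le> v1"
  shows "ereal C \<le> C_max v0 v1 \<longleftrightarrow> C * sqrt v0 \<le> 1 \<and> C * sqrt v1 \<le> 1"
proof -
  \<comment> \<open>The product form also covers v = 0, where the extended bound is
    infinite.\<close>
  have "ereal C \<le> inverse (ereal (sqrt v)) \<longleftrightarrow> C * sqrt v \<le> 1" if "0 \<le> v" for v
    using that by (cases "v = 0") (auto simp: field_simps)
  then show ?thesis using assms by (auto simp: C_max_def)
qed

lemma C_max_nonneg: "0 \<le> v0 \<Longrightarrow> 0 \<le> v1 \<Longrightarrow> 0 \<le> C_max v0 v1"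
  using le_C_max_iff[of 0 v0 v1] by (simp add: zero_ereal_def)

lemma abs_le_C_max_iff:
  assumes "0 \<le> v0" "0 \<le> v1"
  shows "- C_max v0 v1 \<le> ereal C \<and> ereal C \<le> C_max v0 v1 \<longleftrightarrow>
         \<bar>C * sqrt v0\<bar> \<le> 1 \<and> \<bar>C * sqrt v1\<bar> \<le> 1"
proof -
  have "- C_max v0 v1 \<le> ereal C \<longleftrightarrow> ereal (- C) \<le> C_max v0 v1"
    using ereal_uminus_le_reorder[of "C_max v0 v1" "ereal C"] by simp
  then have "- C_max v0 v1 \<le> ereal C \<and> ereal C \<le> C_max v0 v1 \<longleftrightarrow> ereal \<bar>C\<bar> \<le> C_max v0 v1"
    using C_max_nonneg[OF assms] order_trans[of "ereal C" 0 "C_max v0 v1"] order_trans[of "ereal (- C)" 0 "C_max v0 v1"]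
    by (cases "0 \<le> C") auto
  then show ?thesis using assms by (simp add: le_C_max_iff abs_mult)
qed

lemma heston_threshold_self: "heston_threshold v v = 0"
  by (simp add: heston_threshold_def heston_F_def)

lemma arcsin_rhs_ex1:
  assumes "0 \<le> v0" "0 \<le> v1" "X \<noteq> 0" "\<bar>X\<bar> \<le> heston_threshold (min v0 v1) (max v0 v1)"
  shows "\<exists>!C. \<bar>C * sqrt v0\<bar> \<le> 1 \<and> \<bar>C * sqrt v1\<bar> \<le> 1 \<and> X = arcsin_rhs v0 v1 C"
proof -
  define m M where "m = min v0 v1" and "M = max v0 v1"
  \<comment> \<open>For equal heights the threshold is 0, which would force X = 0.\<close>
  have "v0 \<noteq> v1" using assms heston_threshold_self[of v0] by auto
  then have mM: "0 \<le> m" "m < M" using assms by (auto simp: m_def M_def)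
  have iff: "\<bar>C * sqrt v0\<bar> \<le> 1 \<and> \<bar>C * sqrt v1\<bar> \<le> 1 \<longleftrightarrow> \<bar>C\<bar> \<le> 1 / sqrt M" for C
  proof -
    have "\<bar>C\<bar> \<le> 1 / sqrt M \<longleftrightarrow> \<bar>C\<bar> * sqrt M \<le> 1" using mM by (simp add: field_simps)
    moreover have "\<bar>C\<bar> * sqrt m \<le> \<bar>C\<bar> * sqrt M" using mM by (intro mult_left_mono) auto
    ultimately show ?thesis using assms by (auto simp: abs_mult m_def M_def min_def max_def split: if_splits)
  qed
  \<comment> \<open>Exchanging the two heights changes the sign of F, hence of the target
    value.\<close>
  define \<sigma> :: real where "\<sigma> = (if v0 \<le> v1 then 1 else - 1)"
  have rhs: "X = arcsin_rhs v0 v1 C \<longleftrightarrow> heston_F m M C = \<sigma> * X" for C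
    by (auto simp: arcsin_rhs_eq_heston_F heston_F_def m_def M_def \<sigma>_def)
  have "\<bar>\<sigma> * X\<bar> \<le> heston_F m M (1 / sqrt M)" "\<sigma> * X \<noteq> 0"
    using assms(3,4) mM by (auto simp: heston_threshold_def \<sigma>_def simp flip: m_def M_def)
  then show ?thesis
    unfolding conj_assoc[symmetric] iff rhs by (intro heston_F_unique[OF mM]) auto
qed

text \<open>At C = 1 / sqrt M the higher end is the top of the arch, where the two kinds of arc
  coincide. Thus the arccosine equation takes over exactly where the arcsine equation stops.\<close>

lemma heston_threshold_eq_arccos_rhs:
  assumes "0 \<le> v0" "0 \<le> v1" "0 < max v0 v1"
  shows "heston_threshold (min v0 v1) (max v0 v1) = arccos_rhs v0 v1 (1 / sqrt (max v0 v1))"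
proof -
  have "heston_F m M (1 / sqrt M) = arccos_rhs m M (1 / sqrt M)" if "0 \<le> m" "m \<le> M" "0 < M" for m M
  proof -
    have "0 \<le> sqrt m / sqrt M" using that by simp
    then have "- 1 \<le> sqrt m / sqrt M" by linarith
    then have arccos: "arccos (sqrt m / sqrt M) = pi / 2 - arcsin (sqrt m / sqrt M)"
      using that by (intro arccos_arcsin_eq) auto
    have sq: "(1 / sqrt M)\<^sup>2 = 1 / M" using that by (simp add: power_divide)
    have "heston_F m M (1 / sqrt M)
        = M * (pi / 2) - M * arcsin (sqrt m / sqrt M) + sqrt m * sqrt (1 - m / M) * sqrt M"
      using that unfolding heston_F_def Fbar_def sq by (simp add: mult.commute)
    moreover have "arccos_rhs m M (1 / sqrt M)
        = sqrt m * sqrt (1 - m / M) * sqrt M + M * arccos (sqrt m / sqrt M)"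
      using that unfolding arccos_rhs_def sq by (simp add: mult.commute)
    ultimately show ?thesis by (simp add: arccos right_diff_distrib)
  qed
  from this[of "min v0 v1" "max v0 v1"]
  have "heston_threshold (min v0 v1) (max v0 v1)
      = arccos_rhs (min v0 v1) (max v0 v1) (1 / sqrt (max v0 v1))"
    using assms by (simp add: heston_threshold_def)
  also have "\<dots> = arccos_rhs v0 v1 (1 / sqrt (max v0 v1))"
    by (cases "v0 \<le> v1") (simp_all add: arccos_rhs_def max_def min_def)
  finally show ?thesis .
qed

lemma arccos_rhs_ex1:
  assumes "0 \<le> v0" "0 \<le> v1" "0 < X" "heston_threshold (min v0 v1) (max v0 v1) \<le> X"
  shows "\<exists>!C. 0 < C \<and> (C * sqrt v0 \<le> 1 \<and> C * sqrt v1 \<le> 1) \<and> X = arccos_rhs v0 v1 C"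
proof (rule ex_ex1I)
  have "\<exists>B>0. B * sqrt v0 \<le> 1 \<and> B * sqrt v1 \<le> 1 \<and> arccos_rhs v0 v1 B \<le> X"
  proof (cases "max v0 v1 = 0")
    case True
    then have "v0 = 0" "v1 = 0" using assms by auto
    then show ?thesis
      \<comment> \<open>With both heights 0 the right-hand side is pi / C^2, so this parameter
        attains X.\<close>
      using assms by (intro exI[of _ "sqrt (pi / X)"]) (simp add: arccos_rhs_def field_simps)
  next
    case False
    then have M: "0 < max v0 v1" using assms by auto
    then show ?thesis
      using assms heston_threshold_eq_arccos_rhs[OF assms(1,2) M]
      by (intro exI[of _ "1 / sqrt (max v0 v1)"]) auto
  qed
  then obtain B where B: "0 < B" "B * sqrt v0 \<le> 1" "B * sqrt v1 \<le> 1" "arccos_rhs v0 v1 B \<le> X" by blast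
  obtain C where C: "0 < C" "C \<le> B" "arccos_rhs v0 v1 C = X"
    using arccos_rhs_surj[OF B(1-3) assms(1,2) B(4) assms(3)] by blast
  have "C * sqrt v0 \<le> B * sqrt v0" "C * sqrt v1 \<le> B * sqrt v1"
    using C assms by (auto intro: mult_right_mono)
  then show "\<exists>C. 0 < C \<and> (C * sqrt v0 \<le> 1 \<and> C * sqrt v1 \<le> 1) \<and> X = arccos_rhs v0 v1 C"
    using B C by (intro exI[of _ C]) linarith
next
  fix C C'
  assume "0 < C \<and> (C * sqrt v0 \<le> 1 \<and> C * sqrt v1 \<le> 1) \<and> X = arccos_rhs v0 v1 C"
    and "0 < C' \<and> (C' * sqrt v0 \<le> 1 \<and> C' * sqrt v1 \<le> 1) \<and> X = arccos_rhs v0 v1 C'"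
  then show "C = C'"
    using arccos_rhs_less[of C C' v0 v1] arccos_rhs_less[of C' C v0 v1] assms
    by (cases C C' rule: linorder_cases) auto
qed

text \<open>Below the threshold the arcsine equation supplies the arc, above it the arccosine
  equation.\<close>

lemma ex_cyc_arc:
  assumes "0 \<le> v0" "0 \<le> v1" "x0 \<noteq> x1"
  shows "\<exists>a r \<phi> \<psi>. 0 < r \<and> \<phi> \<in> {0..pi} \<and> \<psi> \<in> {0..pi} \<and>
    (x0, v0) = cyc_point a r \<phi> \<and> (x1, v1) = cyc_point a r \<psi>"
proof (cases "\<bar>x1 - x0\<bar> \<le> heston_threshold (min v0 v1) (max v0 v1)")
  case True
  then obtain C where C: "\<bar>C * sqrt v0\<bar> \<le> 1" "\<bar>C * sqrt v1\<bar> \<le> 1" "x1 - x0 = arcsin_rhs v0 v1 C"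
    using arcsin_rhs_ex1[of v0 v1 "x1 - x0"] assms by auto
  then have "C \<noteq> 0" using assms(3) by (auto simp: arcsin_rhs_def)
  then have "0 < 1 / C\<^sup>2" by simp
  with arcsin_rhs_arc[OF \<open>C \<noteq> 0\<close> assms(1,2) C] show ?thesis by blast
next
  case False
  then obtain C where C: "0 < C" "C * sqrt v0 \<le> 1" "C * sqrt v1 \<le> 1" "\<bar>x1 - x0\<bar> = arccos_rhs v0 v1 C"
    using arccos_rhs_ex1[of v0 v1 "\<bar>x1 - x0\<bar>"] assms by auto
  then have "0 < 1 / C\<^sup>2" by simp
  with arccos_rhs_arc[OF C(1) assms(1,2) C(2-4)] show ?thesis by blast
qed

subsection \<open>Distances in the closed half-plane\<close>

lemma open_arc_angle:
  assumes "cyc_point a r \<phi> \<in> open_half_plane" "\<phi> \<in> {0..pi}"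
  shows "0 < \<phi>" "\<phi> < pi"
  using assms by (auto simp: open_half_plane_def cyc_point_def less_le)

text \<open>The distance is a maximum of eikonal differences, so their common modulus of continuity
  passes to it.\<close>

lemma heston_dist_open_eq_eikonal:
  assumes "p \<in> open_half_plane" "q \<in> open_half_plane" "fst p \<noteq> fst q"
  shows "\<exists>a. heston_dist_open p q = \<bar>eikonal a (fst q) (snd q) - eikonal a (fst p) (snd p)\<bar>"
    and "\<bar>eikonal b (fst q) (snd q) - eikonal b (fst p) (snd p)\<bar> \<le> heston_dist_open p q"
proof -
  obtain a r \<phi> \<psi> where arc: "0 < r" "\<phi> \<in> {0..pi}" "\<psi> \<in> {0..pi}"
      "p = cyc_point a r \<phi>" "q = cyc_point a r \<psi>"
    using ex_cyc_arc[of "snd p" "snd q" "fst p" "fst q"] assms by (auto simp: open_half_plane_def)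
  note open_arc_angle[of a r \<phi>] open_arc_angle[of a r \<psi>]
  then have "0 < \<phi>" "\<phi> < pi" "0 < \<psi>" "\<psi> < pi" using arc assms by auto
  note dist = heston_dist_open_cyc_point_eikonal[OF arc(1) this]
  show "\<exists>a. heston_dist_open p q = \<bar>eikonal a (fst q) (snd q) - eikonal a (fst p) (snd p)\<bar>"
    unfolding arc by (intro exI[of _ a] dist(3)[symmetric])
  show "\<bar>eikonal b (fst q) (snd q) - eikonal b (fst p) (snd p)\<bar> \<le> heston_dist_open p q"
    using dist(2)[of b a] arc by auto
qed

text \<open>The arc may end on the boundary, so both end angles are first pulled towards the top by
  a fraction s, which scales its length by 1 - s. The estimate holds for s in (0, 1) and passes to s
  = 0 by continuity.\<close>

lemma heston_dist_open_arc_approx: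
  assumes arc: "0 < r" "\<phi> \<in> {0..pi}" "\<psi> \<in> {0..pi}"
    and open': "p \<in> open_half_plane" "q \<in> open_half_plane" "fst p \<noteq> fst q"
  shows "\<bar>heston_dist_open p q - 2 * sqrt r * \<bar>\<psi> - \<phi>\<bar>\<bar>
      \<le> route_bound p (cyc_point a r \<phi>) + route_bound q (cyc_point a r \<psi>)"
proof -
  define P where "P \<phi> s = cyc_point a r (\<phi> + s * (pi / 2 - \<phi>))" for \<phi> s
  \<comment> \<open>The slack in the claimed inequality for the shortened arc; G 0 is the slack in
    the goal.\<close>
  define G where "G s = route_bound p (P \<phi> s) + route_bound q (P \<psi> s)
      - \<bar>heston_dist_open p q - 2 * sqrt r * ((1 - s) * \<bar>\<psi> - \<phi>\<bar>)\<bar>" for s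
  have inside: "0 < \<phi> + s * (pi / 2 - \<phi>)" "\<phi> + s * (pi / 2 - \<phi>) < pi"
    if "\<phi> \<in> {0..pi}" "0 < s" "s < 1" for \<phi> s
  proof -
    have "\<phi> + s * (pi / 2 - \<phi>) = (1 - s) * \<phi> + s * (pi / 2)" by (simp add: algebra_simps)
    moreover have "0 \<le> (1 - s) * \<phi>" "(1 - s) * \<phi> \<le> (1 - s) * pi" using that by auto
    moreover have "0 < s * (pi / 2)" "s * (pi / 2) < s * pi" using that by auto
    moreover have "(1 - s) * pi + s * pi = pi" by (simp add: algebra_simps)
    ultimately show "0 < \<phi> + s * (pi / 2 - \<phi>)" "\<phi> + s * (pi / 2 - \<phi>) < pi"
      by linarith+
  qed
  have nonneg: "0 \<le> G s" if s: "0 < s" "s < 1" for s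
  proof -
    note arc_dist = heston_dist_open_cyc_point_eikonal[where a = a, OF arc(1) inside[OF arc(2) s] inside[OF arc(3) s], folded P_def]
    have Po: "P \<phi> s \<in> open_half_plane" "P \<psi> s \<in> open_half_plane"
      using inside[OF arc(2) s] inside[OF arc(3) s] arc(1)
      by (auto simp: P_def cyc_point_def open_half_plane_def intro!: mult_pos_pos zero_less_power sin_gt_zero)
    have "\<psi> + s * (pi / 2 - \<psi>) - (\<phi> + s * (pi / 2 - \<phi>)) = (1 - s) * (\<psi> - \<phi>)"
      by (simp add: algebra_simps)
    then have D: "2 * sqrt r * ((1 - s) * \<bar>\<psi> - \<phi>\<bar>) = heston_dist_open (P \<phi> s) (P \<psi> s)"
      using arc_dist(1) s by (simp add: abs_mult)
    obtain b where b: "heston_dist_open p q = \<bar>eikonal b (fst q) (snd q) - eikonal b (fst p) (snd p)\<bar>"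
      using heston_dist_open_eq_eikonal(1)[OF open'] by blast
    show ?thesis
      \<comment> \<open>The centre b attains the distance from p to q and gives the upper estimate;
        the centre a attains the length of the shortened arc and gives the lower one.\<close>
      using arc_dist(2)[of b] arc_dist(3) b heston_dist_open_eq_eikonal(2)[OF open', of a]
        eikonal_route_bound[OF open'(1) Po(1), of a] eikonal_route_bound[OF open'(2) Po(2), of a]
        eikonal_route_bound[OF open'(1) Po(1), of b] eikonal_route_bound[OF open'(2) Po(2), of b]
      unfolding G_def D by linarith
  qed
  have "isCont G 0"
    unfolding G_def[abs_def] P_def cyc_point_def route_bound_def fst_conv snd_conv
    by (intro continuous_intros)
  then have "(G \<longlongrightarrow> G 0) (at_right 0)"
    unfolding isCont_def by (rule filterlim_mono[OF _ order_refl at_le]) simp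
  moreover have "eventually (\<lambda>s. 0 \<le> G s) (at_right 0)"
    using eventually_at_right_real[of 0 1] by (auto elim!: eventually_mono intro: nonneg)
  ultimately have "0 \<le> G 0"
    by (intro tendsto_lowerbound[of G]) auto
  then show ?thesis by (simp add: G_def P_def)
qed

lemma closure_open_half_plane:
  assumes "0 \<le> v"
  shows "(x, v) \<in> closure open_half_plane"
  unfolding closure_approachable
proof (intro allI impI)
  fix e :: real assume e: "0 < e"
  show "\<exists>y\<in>open_half_plane. dist y (x, v) < e"
    using e assms
    by (intro bexI[of _ "(x, v + e / 2)"]) (auto simp: open_half_plane_def dist_Pair_Pair dist_real_def)
qed

text \<open>If an end lies on the boundary, the formula is the limit of distances between nearby
  interior points, as the route bounds to the ends of the arc tend to 0.\<close>

lemma heston_dist_arc: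
  assumes arc: "0 < r" "\<phi> \<in> {0..pi}" "\<psi> \<in> {0..pi}"
    and p: "p = cyc_point a r \<phi>" and q: "q = cyc_point a r \<psi>"
    and ne: "fst p \<noteq> fst q"
  shows "heston_dist p q = 2 * sqrt r * \<bar>\<psi> - \<phi>\<bar>"
proof (cases "p \<in> open_half_plane \<and> q \<in> open_half_plane")
  case True
  then have "0 < \<phi>" "\<phi> < pi" "0 < \<psi>" "\<psi> < pi"
    using open_arc_angle arc p q by blast+
  then show ?thesis
    using True heston_dist_open_cyc_point_eikonal(1)[OF arc(1), of \<phi> \<psi> a] p q by (simp add: heston_dist_def)
next
  case False
  let ?O = "open_half_plane \<times> open_half_plane"
  let ?F = "at (p, q) within ?O"
  have v: "0 \<le> snd p" "0 \<le> snd q" using arc(1) by (auto simp: p q cyc_point_def)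
  have "(p, q) \<in> closure ?O"
    using v closure_open_half_plane[of "snd p" "fst p"] closure_open_half_plane[of "snd q" "fst q"]
    by (simp add: closure_Times)
  \<comment> \<open>Without this the value of \<open>Lim\<close> would not be determined. The pair
    lies in the closure but not in the set itself.\<close>
  then have nontriv: "\<not> trivial_limit ?F"
    using False by (auto simp: closure_def trivial_limit_within)
  let ?D = "2 * sqrt r * \<bar>\<psi> - \<phi>\<bar>"
  let ?B = "\<lambda>z. route_bound (fst z) p + route_bound (snd z) q"
  have "((\<lambda>z. heston_dist_open (fst z) (snd z) - ?D) \<longlongrightarrow> 0) ?F"
  proof (rule Lim_null_comparison)
    have "((\<lambda>z. fst (fst z) - fst (snd z)) \<longlongrightarrow> fst (fst (p, q)) - fst (snd (p, q))) ?F"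
      by (intro tendsto_intros)
    then have "eventually (\<lambda>z. fst (fst z) - fst (snd z) \<noteq> 0) ?F"
      by (rule tendsto_imp_eventually_ne) (use ne in simp)
    moreover have "eventually (\<lambda>z. z \<in> ?O) ?F"
      by (auto simp: eventually_at_topological)
    ultimately show "eventually (\<lambda>z. norm (heston_dist_open (fst z) (snd z) - ?D) \<le> ?B z) ?F"
      by eventually_elim (use heston_dist_open_arc_approx[OF arc, of _ _ a] p q in auto)
    have "continuous ?F ?B"
      unfolding route_bound_def by (intro continuous_intros)
    then have "(?B \<longlongrightarrow> ?B (p, q)) ?F"
      by (simp add: continuous_within)
    then show "(?B \<longlongrightarrow> 0) ?F"
      by (simp add: route_bound_def)
  qed
  then have "((\<lambda>z. heston_dist_open (fst z) (snd z)) \<longlongrightarrow> ?D) ?F"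
    by (rule LIM_zero_cancel)
  then have "Lim ?F (\<lambda>z. heston_dist_open (fst z) (snd z)) = ?D"
    by (rule tendsto_Lim[OF nontriv])
  moreover have "(\<lambda>z. heston_dist_open (fst z) (snd z)) = (\<lambda>(p', q'). heston_dist_open p' q')"
    by (simp add: case_prod_unfold)
  ultimately show ?thesis
    using False unfolding heston_dist_def by (simp only: if_False)
qed

section \<open>The two distance formulas\<close>

lemma heston_dist_arcsin:
  assumes "0 \<le> v0" "0 \<le> v1" "x0 \<noteq> x1"
    and C: "\<bar>C * sqrt v0\<bar> \<le> 1" "\<bar>C * sqrt v1\<bar> \<le> 1" "x1 - x0 = arcsin_rhs v0 v1 C"
  shows "heston_dist (x0, v0) (x1, v1)
    = 2 * ((arcsin (C * sqrt (max v0 v1)) - arcsin (C * sqrt (min v0 v1))) / C)"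
proof -
  have "C \<noteq> 0" using assms(3) C by (auto simp: arcsin_rhs_def)
  note arc = arcsin_rhs_arc[OF this assms(1,2) C]
  define \<alpha> where "\<alpha> v = arcsin (C * sqrt v)" for v
  obtain a where a: "(x0, v0) = cyc_point a (1 / C\<^sup>2) (if 0 < C then \<alpha> v0 else pi + \<alpha> v0)"
    "(x1, v1) = cyc_point a (1 / C\<^sup>2) (if 0 < C then \<alpha> v1 else pi + \<alpha> v1)"
    using arc(1) unfolding \<alpha>_def by blast
  have "heston_dist (x0, v0) (x1, v1) = 2 * sqrt (1 / C\<^sup>2)
      * \<bar>(if 0 < C then \<alpha> v1 else pi + \<alpha> v1) - (if 0 < C then \<alpha> v0 else pi + \<alpha> v0)\<bar>"
    by (rule heston_dist_arc[OF _ _ _ a]) (use \<open>C \<noteq> 0\<close> arc(2,3) assms(3) in \<open>auto simp: \<alpha>_def\<close>)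
  also have "\<dots> = 2 * (\<bar>\<alpha> v1 - \<alpha> v0\<bar> / \<bar>C\<bar>)"
    by (simp add: real_sqrt_divide)
  also have "\<bar>\<alpha> v1 - \<alpha> v0\<bar> = \<bar>\<alpha> (max v0 v1) - \<alpha> (min v0 v1)\<bar>"
    by (simp add: max_def min_def abs_minus_commute)
  \<comment> \<open>The angle is monotone in the height, in the direction given by the sign of C, so
    the signed quotient is nonnegative.\<close>
  also have "\<dots> / \<bar>C\<bar> = (\<alpha> (max v0 v1) - \<alpha> (min v0 v1)) / C"
  proof -
    define M m where "M = max v0 v1" and "m = min v0 v1"
    have b: "\<bar>C * sqrt m\<bar> \<le> 1" "\<bar>C * sqrt M\<bar> \<le> 1" "m \<le> M"
      using C by (auto simp: M_def m_def min_def max_def)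
    have "0 \<le> (\<alpha> M - \<alpha> m) / C"
    proof (cases "0 < C")
      case True
      then have "C * sqrt m \<le> C * sqrt M" using b by simp
      then have "\<alpha> m \<le> \<alpha> M" unfolding \<alpha>_def using b by (intro arcsin_le_arcsin) auto
      then show ?thesis using True by simp
    next
      case False
      then have "C * sqrt M \<le> C * sqrt m" using b by (simp add: mult_left_mono_neg)
      then have "\<alpha> M \<le> \<alpha> m" unfolding \<alpha>_def using b by (intro arcsin_le_arcsin) auto
      then show ?thesis using False by (simp add: divide_nonpos_nonpos)
    qed
    then show ?thesis by (simp add: M_def m_def flip: abs_divide)
  qed
  finally show ?thesis by (simp add: \<alpha>_def)
qed

lemma heston_dist_arccos:
  assumes "0 \<le> v0" "0 \<le> v1" "x0 \<noteq> x1"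
    and C: "0 < C" "C * sqrt v0 \<le> 1" "C * sqrt v1 \<le> 1" "\<bar>x1 - x0\<bar> = arccos_rhs v0 v1 C"
  shows "heston_dist (x0, v0) (x1, v1)
    = 2 * ((arccos (C * sqrt v0) + arccos (C * sqrt v1)) / C)"
proof -
  note arc = arccos_rhs_arc[OF C(1) assms(1,2) C(2-4)]
  obtain a where a: "(x0, v0) = cyc_point a (1 / C\<^sup>2)
        (if x0 \<le> x1 then arcsin (C * sqrt v0) else pi - arcsin (C * sqrt v0))"
    "(x1, v1) = cyc_point a (1 / C\<^sup>2)
        (if x0 \<le> x1 then pi - arcsin (C * sqrt v1) else arcsin (C * sqrt v1))"
    using arc(1) by blast
  have "heston_dist (x0, v0) (x1, v1) = 2 * sqrt (1 / C\<^sup>2) * (arccos (C * sqrt v0) + arccos (C * sqrt v1))"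
    unfolding arc(4)[symmetric]
    by (rule heston_dist_arc[OF _ arc(2,3) a]) (use C(1) assms(3) in auto)
  then show ?thesis using C(1) by (simp add: real_sqrt_divide)
qed

theorem theorem1:
  fixes x0 v0 x1 v1 m M :: real
  assumes "v0 \<ge> 0" and "v1 \<ge> 0" and "x0 \<noteq> x1"
    and "m = min v0 v1" and "M = max v0 v1"
  shows "(\<bar>x1 - x0\<bar> \<le> heston_threshold m M \<longrightarrow>
           (\<exists>!C. - C_max v0 v1 \<le> ereal C \<and> ereal C \<le> C_max v0 v1 \<and>
                 x1 - x0 = arcsin_rhs v0 v1 C) \<and>
           (\<forall>C. - C_max v0 v1 \<le> ereal C \<and> ereal C \<le> C_max v0 v1 \<and>
                 x1 - x0 = arcsin_rhs v0 v1 C \<longrightarrow>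
                 heston_dist (x0, v0) (x1, v1)
                   = 2 * ((arcsin (C * sqrt M) - arcsin (C * sqrt m)) / C)))
       \<and> (\<bar>x1 - x0\<bar> \<ge> heston_threshold m M \<longrightarrow>
           (\<exists>!C. 0 < C \<and> ereal C \<le> C_max v0 v1 \<and>
                 \<bar>x1 - x0\<bar> = arccos_rhs v0 v1 C) \<and>
           (\<forall>C. 0 < C \<and> ereal C \<le> C_max v0 v1 \<and>
                 \<bar>x1 - x0\<bar> = arccos_rhs v0 v1 C \<longrightarrow>
                 heston_dist (x0, v0) (x1, v1)
                   = 2 * ((arccos (C * sqrt v0) + arccos (C * sqrt v1)) / C)))"
proof -
  have i: "- C_max v0 v1 \<le> ereal C \<and> ereal C \<le> C_max v0 v1 \<and> x1 - x0 = arcsin_rhs v0 v1 C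
      \<longleftrightarrow> \<bar>C * sqrt v0\<bar> \<le> 1 \<and> \<bar>C * sqrt v1\<bar> \<le> 1 \<and> x1 - x0 = arcsin_rhs v0 v1 C" for C
    using abs_le_C_max_iff[OF assms(1,2), of C] by blast
  have ii: "0 < C \<and> ereal C \<le> C_max v0 v1 \<and> \<bar>x1 - x0\<bar> = arccos_rhs v0 v1 C
      \<longleftrightarrow> 0 < C \<and> (C * sqrt v0 \<le> 1 \<and> C * sqrt v1 \<le> 1) \<and> \<bar>x1 - x0\<bar> = arccos_rhs v0 v1 C" for C
    using le_C_max_iff[OF _ assms(1,2), of C] by auto
  show ?thesis
    unfolding i ii assms(4,5)
    using arcsin_rhs_ex1[OF assms(1,2), of "x1 - x0"] arccos_rhs_ex1[OF assms(1,2), of "\<bar>x1 - x0\<bar>"]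
      heston_dist_arcsin[OF assms(1-3)] heston_dist_arccos[OF assms(1-3)] assms(3)
    by auto
qed

end
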